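(* Let $c\in(0,1]$ and let $X$ be a separable Banach space whose norm is $c$-Lipschitz weak-star Kadec-Klee. Then for every $\varepsilon>0$ there is a closed linear subspace $E$ of $c_0(\mathbb N)$ with $d_{BM}(X,E)\le \frac1{c^2}+\varepsilon$.
   Context: For a separable Banach space $X$ and $c\in(0,1]$, the norm of $X$ is called $c$-Lipschitz weak-star Kadec-Klee ($c$-$LKK^*$) if its dual norm satisfies: for every $x^*\in X^*$ and every weak$^*$-null sequence $(x_n^* )$ in $X^*$, $\limsup_n\|x^*+x_n^*\|\ge \|x^*\|+c\,\limsup_n\|x_n^*\|$. $d_{BM}(X,E)=\inf\{\|T\|\,\|T^{-1}\|: T:X\to E \text{ linear isomorphism onto}\}$ is the Banach-Mazur distance. *)

theory Defs
  imports "HOL-Analysis.Analysis" "HOL-Library.Liminf_Limsup"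
begin

(* Real Banach spaces are modelled by types of class banach; the dual space X* is
  the type of bounded linear functionals 'a =>L real with its operator norm. *)

definition separable_space :: "'a::metric_space itself \<Rightarrow> bool" where
  "separable_space _ \<longleftrightarrow> (\<exists>D::'a set. countable D \<and> closure D = UNIV)"

definition weak_star_null :: "(nat \<Rightarrow> ('a::real_normed_vector \<Rightarrow>\<^sub>L real)) \<Rightarrow> bool" where
  "weak_star_null xs \<longleftrightarrow> (\<forall>x. (\<lambda>n. blinfun_apply (xs n) x) \<longlonglongrightarrow> 0)"

definition c_LKK_star :: "real \<Rightarrow> 'a::real_normed_vector itself \<Rightarrow> bool" where
  "c_LKK_star c _ \<longleftrightarrow>
     (\<forall>(f::'a \<Rightarrow>\<^sub>L real) xs. weak_star_null xs \<longrightarrow>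
        limsup (\<lambda>n. ereal (norm (f + xs n)))
          \<ge> ereal (norm f) + ereal c * limsup (\<lambda>n. ereal (norm (xs n))))"

definition c0 :: "(nat \<Rightarrow> real) set" where
  "c0 = {f. f \<longlonglongrightarrow> 0}"

definition c0_norm :: "(nat \<Rightarrow> real) \<Rightarrow> real" where
  "c0_norm f = (SUP n. \<bar>f n\<bar>)"

definition c0_linear_subspace :: "(nat \<Rightarrow> real) set \<Rightarrow> bool" where
  "c0_linear_subspace E \<longleftrightarrow> E \<subseteq> c0 \<and> (\<lambda>n. 0) \<in> E \<and>
     (\<forall>f\<in>E. \<forall>g\<in>E. (\<lambda>n. f n + g n) \<in> E) \<and>
     (\<forall>a f. f \<in> E \<longrightarrow> (\<lambda>n. a * f n) \<in> E)"

definition c0_closed :: "(nat \<Rightarrow> real) set \<Rightarrow> bool" where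
  "c0_closed E \<longleftrightarrow> (\<forall>g f. (\<forall>k. g k \<in> E) \<and> f \<in> c0 \<and>
       (\<lambda>k. c0_norm (\<lambda>n. g k n - f n)) \<longlonglongrightarrow> 0 \<longrightarrow> f \<in> E)"

definition linear_to_seq :: "('a::real_vector \<Rightarrow> (nat \<Rightarrow> real)) \<Rightarrow> bool" where
  "linear_to_seq T \<longleftrightarrow> (\<forall>x y. T (x + y) = (\<lambda>n. T x n + T y n)) \<and>
     (\<forall>a x. T (a *\<^sub>R x) = (\<lambda>n. a * T x n))"

definition opnorm_to_c0 :: "('a::real_normed_vector \<Rightarrow> (nat \<Rightarrow> real)) \<Rightarrow> ereal" where
  "opnorm_to_c0 T = (SUP x \<in> {x. norm x \<le> 1}. ereal (c0_norm (T x)))"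

definition opnorm_from_c0 :: "(nat \<Rightarrow> real) set \<Rightarrow> ((nat \<Rightarrow> real) \<Rightarrow> 'a::real_normed_vector) \<Rightarrow> ereal" where
  "opnorm_from_c0 E S = (SUP y \<in> {y \<in> E. c0_norm y \<le> 1}. ereal (norm (S y)))"

definition bm_dist_c0 :: "'a::real_normed_vector itself \<Rightarrow> (nat \<Rightarrow> real) set \<Rightarrow> ereal" where
  "bm_dist_c0 _ E = (INF T \<in> {T::'a \<Rightarrow> (nat \<Rightarrow> real). linear_to_seq T \<and> bij_betw T UNIV E}.
       opnorm_to_c0 T * opnorm_from_c0 E (inv_into UNIV T))"

end

theory Submission
  imports Defs
begin

text \<open>
  Let \<open>A m\<close> be the annihilator of the first \<open>m\<close> terms of a dense sequence. By weak-star compactness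
  the Kadec--Klee condition becomes uniform: for \<open>h\<close> in a set covered by finitely many small balls
  and bounded \<open>y \<in> A m\<close> with \<open>m\<close> large, \<open>\<parallel>h\<parallel> + c \<parallel>y\<parallel> \<le> \<parallel>h + y\<parallel> + \<delta>\<close>. Given \<open>f\<close> of norm at most 1,
  a pigeonhole argument on the distances from \<open>f\<close> to the \<open>A m\<close> yields functionals \<open>g\<^sub>k\<close> with
  \<open>g\<^sub>0 = 0\<close> that agree with \<open>f\<close> on more and more of the dense sequence, lie in finitely covered sets
  independent of \<open>f\<close>, and satisfy \<open>c \<parallel>g\<^sub>k\<^sub>+\<^sub>1 - g\<^sub>k\<parallel> \<le> \<parallel>g\<^sub>k\<^sub>+\<^sub>1\<parallel> - \<parallel>g\<^sub>k\<parallel> + \<eta>\<^sub>k\<close>. Telescoping, \<open>f\<close> is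
  up to a small error a sum of multiples of members of one weak-star null sequence in the dual unit
  ball, with coefficients of total size about \<open>1 / c \<le> 1 / c\<^sup>2\<close>. Evaluating that sequence embeds the
  space into \<open>c\<^sub>0\<close> with distortion about \<open>1 / c\<close>.
\<close>

subsection \<open>Sublinear functionals and the Hahn--Banach theorem\<close>

definition sublinear :: "('a::real_vector \<Rightarrow> real) \<Rightarrow> bool" where
  "sublinear q \<longleftrightarrow> (\<forall>x y. q (x + y) \<le> q x + q y) \<and> (\<forall>a\<ge>0. \<forall>x. q (a *\<^sub>R x) \<le> a * q x)"

lemma sublinear_add: "sublinear q \<Longrightarrow> q (x + y) \<le> q x + q y"
  by (simp add: sublinear_def)

lemma sublinear_zero:
  assumes "sublinear q"
  shows "q 0 = 0"
proof (rule antisym)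
  have "q (0 *\<^sub>R 0) \<le> 0 * q 0"
    using assms unfolding sublinear_def by blast
  then show "q 0 \<le> 0" by simp
  show "0 \<le> q 0"
    using sublinear_add[OF assms, of 0 0] by simp
qed

lemma sublinear_minus: "sublinear q \<Longrightarrow> - q (- x) \<le> q x"
  using sublinear_add[of q x "- x"] sublinear_zero[of q] by simp

lemma sublinear_scaleR:
  assumes "sublinear q" "a \<ge> 0"
  shows "q (a *\<^sub>R x) = a * q x"
proof (cases "a = 0")
  case True
  then show ?thesis using sublinear_zero assms by simp
next
  case False
  with assms have "a > 0" by simp
  then have "q (inverse a *\<^sub>R (a *\<^sub>R x)) \<le> inverse a * q (a *\<^sub>R x)"
    using assms unfolding sublinear_def by (meson inverse_nonnegative_iff_nonnegative)
  then have "a * q x \<le> q (a *\<^sub>R x)"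
    using \<open>a > 0\<close> by (simp add: field_simps)
  moreover have "q (a *\<^sub>R x) \<le> a * q x"
    using assms unfolding sublinear_def by blast
  ultimately show ?thesis by simp
qed

lemma sublinear_norm: "sublinear (norm :: 'a::real_normed_vector \<Rightarrow> real)"
  by (simp add: sublinear_def norm_triangle_ineq)

lemma sublinear_INF:
  fixes q :: "'i \<Rightarrow> 'a::real_vector \<Rightarrow> real"
  assumes "I \<noteq> {}" and bdd: "\<And>x. bdd_below ((\<lambda>i. q i x) ` I)"
    and add: "\<And>i j x y. i \<in> I \<Longrightarrow> j \<in> I \<Longrightarrow> \<exists>k\<in>I. q k (x + y) \<le> q i x + q j y"
    and scale: "\<And>i a x. i \<in> I \<Longrightarrow> 0 \<le> a \<Longrightarrow> \<exists>k\<in>I. q k (a *\<^sub>R x) \<le> a * q i x"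
  shows "sublinear (\<lambda>x. INF i\<in>I. q i x)"
  unfolding sublinear_def
proof (intro conjI allI impI)
  fix x y
  have INF_add_le: "(INF i\<in>I. q i (x + y)) \<le> q i x + q j y" if "i \<in> I" "j \<in> I" for i j
    using add[OF that] cINF_lower2[OF bdd] by blast
  have "(INF i\<in>I. q i (x + y)) - q i x \<le> (INF j\<in>I. q j y)" if "i \<in> I" for i
    using INF_add_le[OF that] by (intro cINF_greatest \<open>I \<noteq> {}\<close>) (simp add: algebra_simps)
  then have "(INF i\<in>I. q i (x + y)) - (INF j\<in>I. q j y) \<le> (INF i\<in>I. q i x)"
    by (intro cINF_greatest \<open>I \<noteq> {}\<close>) (simp add: algebra_simps)
  then show "(INF i\<in>I. q i (x + y)) \<le> (INF i\<in>I. q i x) + (INF i\<in>I. q i y)"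
    by simp
next
  fix a :: real and x assume "0 \<le> a"
  have INF_scale_le: "(INF i\<in>I. q i (a *\<^sub>R x)) \<le> a * q i x" if "i \<in> I" for i
    using scale[OF that \<open>0 \<le> a\<close>] cINF_lower2[OF bdd] by blast
  show "(INF i\<in>I. q i (a *\<^sub>R x)) \<le> a * (INF i\<in>I. q i x)"
  proof (cases "a = 0")
    case True
    then show ?thesis using INF_scale_le \<open>I \<noteq> {}\<close> by auto
  next
    case False
    with \<open>0 \<le> a\<close> have "a > 0" by simp
    then have "(INF i\<in>I. q i (a *\<^sub>R x)) / a \<le> (INF i\<in>I. q i x)"
      using INF_scale_le by (intro cINF_greatest \<open>I \<noteq> {}\<close>) (simp add: field_simps)
    then show ?thesis using \<open>a > 0\<close> by (simp add: field_simps)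
  qed
qed

definition directional_inf :: "('a::real_vector \<Rightarrow> real) \<Rightarrow> 'a \<Rightarrow> 'a \<Rightarrow> real" where
  "directional_inf q y x = (INF t\<in>{0..}. q (x + t *\<^sub>R y) - t * q y)"

lemma bdd_below_directional_inf:
  assumes "sublinear q"
  shows "bdd_below ((\<lambda>t. q (x + t *\<^sub>R y) - t * q y) ` {0..})"
proof (rule bdd_belowI2)
  fix t :: real assume "t \<in> {0..}"
  then have "t * q y = q (t *\<^sub>R y)"
    using sublinear_scaleR[OF assms] by simp
  also have "\<dots> \<le> q (x + t *\<^sub>R y) + q (- x)"
    using sublinear_add[OF assms, of "x + t *\<^sub>R y" "- x"] by simp
  finally show "- q (- x) \<le> q (x + t *\<^sub>R y) - t * q y" by simp
qed

lemma directional_inf_le: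
  assumes "sublinear q" "t \<ge> 0"
  shows "directional_inf q y x \<le> q (x + t *\<^sub>R y) - t * q y"
  unfolding directional_inf_def
  by (intro cINF_lower bdd_below_directional_inf) (use assms in auto)

lemma directional_inf_le_self:
  assumes "sublinear q"
  shows "directional_inf q y \<le> q"
  using directional_inf_le[OF assms, of 0 y] by (simp add: le_fun_def)

lemma sublinear_directional_inf:
  assumes q: "sublinear q"
  shows "sublinear (directional_inf q y)"
  unfolding directional_inf_def
proof (rule sublinear_INF)
  fix s t :: real and x z
  assume "s \<in> {0..}" "t \<in> {0..}"
  have "q (x + z + (s + t) *\<^sub>R y) \<le> q (x + s *\<^sub>R y) + q (z + t *\<^sub>R y)"
    using sublinear_add[OF q, of "x + s *\<^sub>R y" "z + t *\<^sub>R y"] by (simp add: algebra_simps)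
  with \<open>s \<in> {0..}\<close> \<open>t \<in> {0..}\<close>
  show "\<exists>k\<in>{0..}. q (x + z + k *\<^sub>R y) - k * q y
      \<le> (q (x + s *\<^sub>R y) - s * q y) + (q (z + t *\<^sub>R y) - t * q y)"
    by (intro bexI[of _ "s + t"]) (auto simp: algebra_simps)
next
  fix t a :: real and x
  assume "t \<in> {0..}" "0 \<le> a"
  then have "q (a *\<^sub>R x + (a * t) *\<^sub>R y) = a * q (x + t *\<^sub>R y)"
    using sublinear_scaleR[OF q, of a "x + t *\<^sub>R y"] by (simp add: scaleR_add_right)
  with \<open>t \<in> {0..}\<close> \<open>0 \<le> a\<close>
  show "\<exists>k\<in>{0..}. q (a *\<^sub>R x + k *\<^sub>R y) - k * q y \<le> a * (q (x + t *\<^sub>R y) - t * q y)"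
    by (intro bexI[of _ "a * t"]) (auto simp: algebra_simps)
qed (simp_all add: bdd_below_directional_inf q)

lemma minimal_sublinear_is_linear:
  assumes q: "sublinear q" and minimal: "\<And>p. sublinear p \<Longrightarrow> p \<le> q \<Longrightarrow> p = q"
  shows "linear q"
proof -
  have "directional_inf q y = q" for y
    by (intro minimal sublinear_directional_inf directional_inf_le_self q)
  then have "q x + q y \<le> q (x + y)" for x y
    using directional_inf_le[OF q, of 1 y x] by simp
  then have add: "q (x + y) = q x + q y" for x y
    using sublinear_add[OF q, of x y] by (simp add: antisym)
  then have minus: "q (- x) = - q x" for x
    using add[of x "- x"] sublinear_zero[OF q] by simp
  have "q (a *\<^sub>R x) = a * q x" for a x
    using sublinear_scaleR[OF q, of a x] sublinear_scaleR[OF q, of "- a" x] minus[of "(-a) *\<^sub>R x"]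
    by (cases "a \<ge> 0") auto
  with add show ?thesis by (intro linearI) auto
qed

lemma sublinear_chain_lower_bound:
  assumes "C \<noteq> {}" and sublin: "\<And>q. q \<in> C \<Longrightarrow> sublinear q" and below: "\<And>q. q \<in> C \<Longrightarrow> q \<le> p"
    and chain: "\<And>q r. q \<in> C \<Longrightarrow> r \<in> C \<Longrightarrow> q \<le> r \<or> r \<le> q"
  shows "\<exists>u. sublinear u \<and> (\<forall>q\<in>C. u \<le> q)"
proof -
  have bdd: "bdd_below ((\<lambda>q. q x) ` C)" for x
  proof (rule bdd_belowI2)
    fix q assume "q \<in> C"
    then show "- p (- x) \<le> q x"
      using sublinear_minus[OF sublin, of q x] below by (smt (verit) le_funD)
  qed
  have "sublinear (\<lambda>x. INF q\<in>C. q x)"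
  proof (rule sublinear_INF[OF \<open>C \<noteq> {}\<close> bdd])
    fix q r x y assume "q \<in> C" "r \<in> C"
    then obtain s where "s \<in> C" "s \<le> q" "s \<le> r"
      using chain[of q r] by blast
    then show "\<exists>s\<in>C. s (x + y) \<le> q x + r y"
      using sublinear_add[OF sublin, of s x y] by (smt (verit) le_funD)
  qed (use sublinear_scaleR[OF sublin] in fastforce)
  moreover have "(\<lambda>x. INF q\<in>C. q x) \<le> q" if "q \<in> C" for q
    using cINF_lower[OF bdd that] by (simp add: le_fun_def)
  ultimately show ?thesis by blast
qed

theorem Hahn_Banach_sublinear:
  assumes "sublinear p"
  shows "\<exists>f. linear f \<and> f \<le> p"
proof -
  define S where "S = {q. sublinear q \<and> q \<le> p}"
  have "\<exists>q\<in>S. \<forall>r\<in>S. q \<ge> r \<longrightarrow> r = q"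
  proof (rule predicate_Zorn)
    show "partial_order_on S (relation_of (\<lambda>x y. y \<le> x) S)"
      by (auto simp: partial_order_on_def preorder_on_def refl_on_def trans_def antisym_def
          relation_of_def)
  next
    fix C assume "C \<in> Chains (relation_of (\<lambda>x y. y \<le> x) S)"
    then have C: "C \<subseteq> S" "\<And>q r. q \<in> C \<Longrightarrow> r \<in> C \<Longrightarrow> q \<le> r \<or> r \<le> q"
      by (auto simp: Chains_def relation_of_def)
    show "\<exists>u\<in>S. \<forall>q\<in>C. u \<le> q"
    proof (cases "C = {}")
      case True
      then show ?thesis using assms by (auto simp: S_def)
    next
      case False
      then obtain u where "sublinear u" "\<forall>q\<in>C. u \<le> q"
        using sublinear_chain_lower_bound[of C p] C unfolding S_def by blast
      then show ?thesis
        using False C(1) unfolding S_def by (blast intro: order_trans)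
    qed
  qed
  then obtain q where "sublinear q" "q \<le> p" "\<And>r. sublinear r \<Longrightarrow> r \<le> q \<Longrightarrow> r = q"
    by (force simp: S_def intro: order_trans)
  then show ?thesis using minimal_sublinear_is_linear by blast
qed

lemma norming_functional:
  fixes x :: "'a::real_normed_vector"
  obtains f :: "'a \<Rightarrow>\<^sub>L real" where "norm f \<le> 1" "f x = norm x"
proof -
  obtain f where "linear f" and below: "f \<le> directional_inf norm x"
    using Hahn_Banach_sublinear[OF sublinear_directional_inf[OF sublinear_norm]] by blast
  have f_le: "f y \<le> norm y" for y
    using below directional_inf_le_self[OF sublinear_norm, of x] by (meson le_funD order_trans)
  have abs_f_le: "\<bar>f y\<bar> \<le> norm y" for y
    using f_le[of y] f_le[of "- y"] linear_neg[OF \<open>linear f\<close>, of y] by simp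
  have "f (- x) \<le> directional_inf norm x (- x)"
    using below by (rule le_funD)
  also have "\<dots> \<le> norm (- x + 1 *\<^sub>R x) - 1 * norm x"
    by (intro directional_inf_le sublinear_norm) simp
  finally have "f (- x) \<le> - norm x" by simp
  then have "f x = norm x"
    using f_le[of x] linear_neg[OF \<open>linear f\<close>, of x] by simp
  have "bounded_linear f"
    using \<open>linear f\<close> abs_f_le
    by (intro bounded_linear_intro[where K = 1]) (auto simp: linear_add linear_scale)
  then have apply_f: "Blinfun f y = f y" for y
    by (simp add: bounded_linear_Blinfun_apply)
  show thesis
  proof
    show "norm (Blinfun f) \<le> 1"
      using abs_f_le by (intro norm_blinfun_bound) (auto simp: apply_f)
    show "Blinfun f x = norm x"
      by (simp add: apply_f \<open>f x = norm x\<close>)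
  qed
qed

subsection \<open>Weak-star null sequences\<close>

lemma norm_blinfun_apply_le:
  assumes "norm f \<le> R"
  shows "norm (blinfun_apply f x) \<le> R * norm x"
  using norm_blinfun[of f x] mult_right_mono[OF assms norm_ge_zero[of x]] by linarith

lemma convergent_apply_if_convergent_on_dense:
  fixes h :: "nat \<Rightarrow> 'a::real_normed_vector \<Rightarrow>\<^sub>L 'b::banach"
  assumes dense: "closure D = UNIV" and bound: "\<And>n. norm (h n) \<le> R"
    and conv: "\<And>x. x \<in> D \<Longrightarrow> convergent (\<lambda>n. h n x)"
  shows "convergent (\<lambda>n. h n x)"
proof (rule Cauchy_convergent, rule metric_CauchyI)
  fix e :: real assume "e > 0"
  have "R \<ge> 0" using bound[of 0] norm_ge_zero order_trans by blast
  have "x \<in> closure D" by (simp add: dense)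
  moreover have "e / (3 * (R + 1)) > 0" using \<open>e > 0\<close> \<open>R \<ge> 0\<close> by simp
  ultimately obtain y where "y \<in> D" and y: "dist y x < e / (3 * (R + 1))"
    unfolding closure_approachable by blast
  have near: "dist (h n x) (h n y) \<le> e / 3" for n
  proof -
    have "norm (h n (x - y)) \<le> R * norm (x - y)"
      using bound by (rule norm_blinfun_apply_le)
    also have "\<dots> \<le> (R + 1) * (e / (3 * (R + 1)))"
      using y \<open>R \<ge> 0\<close> by (intro mult_mono) (auto simp: dist_norm norm_minus_commute)
    also have "\<dots> = e / 3" using \<open>R \<ge> 0\<close> by (simp add: divide_simps)
    finally show ?thesis by (simp add: blinfun.diff_right dist_norm)
  qed
  obtain N where N: "\<And>m n. m \<ge> N \<Longrightarrow> n \<ge> N \<Longrightarrow> dist (h m y) (h n y) < e / 3"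
    using metric_CauchyD[OF convergent_Cauchy[OF conv[OF \<open>y \<in> D\<close>]], of "e / 3"] \<open>e > 0\<close> by auto
  have "dist (h m x) (h n x) < e" if "m \<ge> N" "n \<ge> N" for m n
    using dist_triangle[of "h m x" "h n x" "h m y"] dist_triangle[of "h m y" "h n x" "h n y"]
      N[OF that] near[of m] near[of n] by (simp add: dist_commute)
  then show "\<exists>M. \<forall>m\<ge>M. \<forall>n\<ge>M. dist (h m x) (h n x) < e" by blast
qed

lemma blinfun_pointwise_limit:
  fixes h :: "nat \<Rightarrow> 'a::real_normed_vector \<Rightarrow>\<^sub>L 'b::real_normed_vector"
  assumes bound: "\<And>n. norm (h n) \<le> R" and conv: "\<And>x. convergent (\<lambda>n. h n x)"
  shows "\<exists>g :: 'a \<Rightarrow>\<^sub>L 'b. \<forall>x. (\<lambda>n. h n x) \<longlonglongrightarrow> g x"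
proof -
  define L where "L x = lim (\<lambda>n. h n x)" for x
  have L: "(\<lambda>n. h n x) \<longlonglongrightarrow> L x" for x
    unfolding L_def using conv[of x] by (simp add: convergent_LIMSEQ_iff)
  have "bounded_linear L"
  proof (rule bounded_linear_intro[where K = R])
    show "L (x + y) = L x + L y" for x y
      using LIMSEQ_unique[OF L[of "x + y"]] tendsto_add[OF L[of x] L[of y]]
      by (simp add: blinfun.add_right)
    show "L (a *\<^sub>R x) = a *\<^sub>R L x" for a x
      using LIMSEQ_unique[OF L[of "a *\<^sub>R x"]] tendsto_scaleR[OF tendsto_const L[of x], of a]
      by (simp add: blinfun.scaleR_right)
    have "norm (h n x) \<le> norm x * R" for n x
      using norm_blinfun_apply_le[OF bound[of n], of x] by (simp add: mult.commute)
    then show "norm (L x) \<le> norm x * R" for x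
      using Lim_bounded[OF tendsto_norm[OF L[of x]], of 0] by blast
  qed
  with L show ?thesis
    by (intro exI[of _ "Blinfun L"]) (simp add: bounded_linear_Blinfun_apply)
qed

lemma weak_star_nullI_dense:
  fixes y :: "nat \<Rightarrow> 'a::real_normed_vector \<Rightarrow>\<^sub>L real"
  assumes dense: "closure D = UNIV" and bound: "\<And>n. norm (y n) \<le> R"
    and null: "\<And>x. x \<in> D \<Longrightarrow> (\<lambda>n. y n x) \<longlonglongrightarrow> 0"
  shows "weak_star_null y"
proof -
  have conv: "convergent (\<lambda>n. y n x)" for x
    by (rule convergent_apply_if_convergent_on_dense[OF dense bound]) (rule convergentI[OF null])
  obtain g :: "'a \<Rightarrow>\<^sub>L real" where g: "\<And>x. (\<lambda>n. y n x) \<longlonglongrightarrow> g x"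
    using blinfun_pointwise_limit[OF bound conv] by blast
  have "g x = 0" for x
  proof (rule continuous_constant_on_closure[where S = D and f = "blinfun_apply g"])
    show "continuous_on (closure D) (blinfun_apply g)"
      by (intro linear_continuous_on blinfun.bounded_linear_right)
    show "g y = 0" if "y \<in> D" for y
      using LIMSEQ_unique[OF g null[OF that]] .
  qed (simp add: dense)
  with g show ?thesis by (simp add: weak_star_null_def)
qed

lemma weak_star_null_subseq:
  assumes "weak_star_null y" "strict_mono r"
  shows "weak_star_null (y \<circ> r)"
  unfolding weak_star_null_def
proof
  fix x
  show "(\<lambda>n. (y \<circ> r) n x) \<longlonglongrightarrow> 0"
    using LIMSEQ_subseq_LIMSEQ[of "\<lambda>n. y n x" 0 r] assms by (simp add: o_def weak_star_null_def)
qed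

lemma bounded_pointwise_imp_convergent_subsequence:
  fixes a :: "nat \<Rightarrow> 'i::countable \<Rightarrow> real"
  assumes "\<And>n i. \<bar>a n i\<bar> \<le> B i"
  obtains r where "strict_mono r" "\<And>i. convergent (\<lambda>n. a (r n) i)"
proof -
  let ?K = "PiE UNIV (\<lambda>i. cball (0::real) (B i))"
  have "compactin (product_topology (\<lambda>_. euclidean) UNIV) ?K"
    by (simp add: compactin_PiE)
  then have "compact ?K"
    by (simp add: euclidean_product_topology)
  then have "seq_compact ?K"
    by (rule compact_imp_seq_compact)
  moreover have "\<forall>n. a n \<in> ?K" using assms by (auto simp: PiE_iff)
  ultimately obtain l r where r: "strict_mono r" "(a \<circ> r) \<longlonglongrightarrow> l"
    by (rule seq_compactE)
  then have "(\<lambda>n. a (r n) i) \<longlonglongrightarrow> l i" for i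
    using continuous_on_tendsto_compose[OF continuous_on_product_coordinates[of i] r(2)] by simp
  with r(1) show thesis by (intro that convergentI)
qed

lemma sequential_Banach_Alaoglu:
  fixes h :: "nat \<Rightarrow> 'a::real_normed_vector \<Rightarrow>\<^sub>L real" and d :: "nat \<Rightarrow> 'a"
  assumes dense: "closure (range d) = UNIV" and bound: "\<And>n. norm (h n) \<le> R"
  obtains r g where "strict_mono r" "weak_star_null (\<lambda>n. h (r n) - g)"
proof -
  have "\<bar>h n (d j)\<bar> \<le> R * norm (d j)" for n j
    using norm_blinfun_apply_le[OF bound[of n], of "d j"] by simp
  then obtain r where "strict_mono r" and "\<And>j. convergent (\<lambda>n. h (r n) (d j))"
    using bounded_pointwise_imp_convergent_subsequence[of "\<lambda>n j. h n (d j)" "\<lambda>j. R * norm (d j)"]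
    by metis
  then have conv: "convergent (\<lambda>n. h (r n) x)" for x
    using convergent_apply_if_convergent_on_dense[OF dense, of "\<lambda>n. h (r n)"] bound by blast
  obtain g :: "'a \<Rightarrow>\<^sub>L real" where "\<And>x. (\<lambda>n. h (r n) x) \<longlonglongrightarrow> g x"
    using blinfun_pointwise_limit[OF bound conv] by blast
  then have "weak_star_null (\<lambda>n. h (r n) - g)"
    by (simp add: weak_star_null_def blinfun.diff_left LIM_zero)
  with \<open>strict_mono r\<close> show thesis by (rule that)
qed

subsection \<open>Distances to annihilators\<close>

lemma infdist_greatest:
  assumes "A \<noteq> {}" "\<And>a. a \<in> A \<Longrightarrow> b \<le> dist x a"
  shows "b \<le> infdist x A"
  unfolding infdist_eq_setdist using assms by (intro le_setdistI) auto

lemma infdist_subspace_le_norm: "subspace V \<Longrightarrow> infdist x V \<le> norm x"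
  using infdist_le[OF subspace_0, of V x] by simp

lemma infdist_diff_subspace:
  fixes x :: "'a::real_normed_vector"
  assumes "subspace V" "v \<in> V"
  shows "infdist (x - v) V = infdist x V"
proof -
  have "infdist y V \<le> infdist (y - w) V" if "w \<in> V" for y w
  proof (rule infdist_greatest)
    show "infdist y V \<le> dist (y - w) a" if "a \<in> V" for a
      using infdist_le[OF subspace_add[OF \<open>subspace V\<close> that \<open>w \<in> V\<close>], of y]
      by (simp add: dist_norm algebra_simps)
  qed (use that in blast)
  from this[of v x] this[of "- v" "x - v"] show ?thesis
    using assms subspace_neg by fastforce
qed

definition annihilator :: "'a::real_normed_vector set \<Rightarrow> ('a \<Rightarrow>\<^sub>L real) set" where
  "annihilator S = {f. \<forall>x\<in>S. blinfun_apply f x = 0}"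

lemma annihilator_insert: "annihilator (insert x S) = {f \<in> annihilator S. blinfun_apply f x = 0}"
  by (auto simp: annihilator_def)

lemma annihilator_antimono: "S \<subseteq> T \<Longrightarrow> annihilator T \<subseteq> annihilator S"
  by (auto simp: annihilator_def)

lemma subspace_annihilator: "subspace (annihilator S)"
  by (auto simp: subspace_def annihilator_def blinfun.add_left blinfun.scaleR_left)

lemma abs_apply_le_infdist_annihilator:
  fixes f :: "'a::real_normed_vector \<Rightarrow>\<^sub>L real"
  assumes "x \<in> S"
  shows "\<bar>f x\<bar> \<le> infdist f (annihilator S) * norm x"
proof (cases "x = 0")
  case False
  have "\<bar>f x\<bar> / norm x \<le> infdist f (annihilator S)"
  proof (rule infdist_greatest)
    show "annihilator S \<noteq> {}" using subspace_0[OF subspace_annihilator] by blast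
  next
    fix g assume "g \<in> annihilator S"
    then have "f x = (f - g) x"
      using assms by (simp add: annihilator_def blinfun.diff_left)
    then have "\<bar>f x\<bar> \<le> dist f g * norm x"
      using norm_blinfun[of "f - g" x] by (simp add: dist_norm)
    then show "\<bar>f x\<bar> / norm x \<le> dist f g"
      using False by (simp add: field_simps)
  qed
  then show ?thesis using False by (simp add: field_simps)
qed simp

lemma infdist_annihilator_insert_le_biorthogonal:
  fixes f u :: "'a::real_normed_vector \<Rightarrow>\<^sub>L real"
  assumes u: "u \<in> annihilator S" "u x = 1"
  shows "infdist f (annihilator (insert x S))
    \<le> (1 + norm u * norm x) * infdist f (annihilator S) + norm u * \<bar>f x\<bar>"
proof -
  define a where "a = 1 + norm u * norm x"
  have "a > 0" by (simp add: a_def add_pos_nonneg)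
  have "(infdist f (annihilator (insert x S)) - norm u * \<bar>f x\<bar>) / a \<le> infdist f (annihilator S)"
  proof (rule infdist_greatest)
    fix g assume g: "g \<in> annihilator S"
    have "g - g x *\<^sub>R u \<in> annihilator (insert x S)"
      using subspace_diff[OF subspace_annihilator g subspace_mul[OF subspace_annihilator u(1)]] u(2)
      by (simp add: annihilator_insert blinfun.diff_left blinfun.scaleR_left)
    then have "infdist f (annihilator (insert x S)) \<le> norm (f - g + g x *\<^sub>R u)"
      using infdist_le[of "g - g x *\<^sub>R u" _ f] by (simp add: dist_norm algebra_simps)
    also have "\<dots> \<le> dist f g + \<bar>g x\<bar> * norm u"
      using norm_triangle_ineq[of "f - g" "g x *\<^sub>R u"] by (simp add: dist_norm)
    also have "\<bar>g x\<bar> \<le> \<bar>f x\<bar> + dist f g * norm x"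
      using norm_blinfun[of "f - g" x] by (simp add: blinfun.diff_left dist_norm)
    finally have "infdist f (annihilator (insert x S)) \<le> a * dist f g + norm u * \<bar>f x\<bar>"
      by (simp add: a_def algebra_simps mult_right_mono)
    then show "(infdist f (annihilator (insert x S)) - norm u * \<bar>f x\<bar>) / a \<le> dist f g"
      using \<open>a > 0\<close> by (simp add: field_simps)
  qed (use u in blast)
  then have "infdist f (annihilator (insert x S)) \<le> a * infdist f (annihilator S) + norm u * \<bar>f x\<bar>"
    using \<open>a > 0\<close> by (simp add: field_simps)
  then show ?thesis by (simp add: a_def)
qed

lemma infdist_annihilator_insert_le:
  fixes x :: "'a::real_normed_vector"
  shows "\<exists>C. \<forall>f. infdist f (annihilator (insert x S))
    \<le> C * (infdist f (annihilator S) + \<bar>blinfun_apply f x\<bar>)"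
proof (cases "\<exists>u\<in>annihilator S. blinfun_apply u x \<noteq> 0")
  case False
  then have "annihilator (insert x S) = annihilator S"
    by (auto simp: annihilator_insert)
  then show ?thesis by (intro exI[of _ 1]) simp
next
  case True
  then obtain v where v: "v \<in> annihilator S" "blinfun_apply v x \<noteq> 0" by blast
  define u where "u = inverse (v x) *\<^sub>R v"
  have u: "u \<in> annihilator S" "u x = 1"
    using v subspace_mul[OF subspace_annihilator] by (auto simp: u_def blinfun.scaleR_left)
  define C where "C = 1 + norm u * norm x + norm u"
  have "infdist f (annihilator (insert x S)) \<le> C * (infdist f (annihilator S) + \<bar>f x\<bar>)"
    for f :: "'a \<Rightarrow>\<^sub>L real"
  proof -
    have "infdist f (annihilator (insert x S))
        \<le> (1 + norm u * norm x) * infdist f (annihilator S) + norm u * \<bar>f x\<bar>"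
      using u by (rule infdist_annihilator_insert_le_biorthogonal)
    also have "\<dots> \<le> C * infdist f (annihilator S) + C * \<bar>f x\<bar>"
      by (intro add_mono mult_right_mono) (simp_all add: C_def infdist_nonneg)
    finally show ?thesis by (simp add: distrib_left)
  qed
  then show ?thesis by blast
qed

text \<open>The dual modulo the annihilator of a finite set is finite dimensional.\<close>

lemma infdist_annihilator_tendsto_0:
  fixes z :: "'b \<Rightarrow> 'a::real_normed_vector \<Rightarrow>\<^sub>L real"
  assumes "finite S" "\<And>x. x \<in> S \<Longrightarrow> ((\<lambda>n. z n x) \<longlongrightarrow> 0) F"
  shows "((\<lambda>n. infdist (z n) (annihilator S)) \<longlongrightarrow> 0) F"
  using assms
proof (induction S)
  case empty
  then show ?case by (simp add: annihilator_def)
next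
  case (insert x S)
  obtain C where C: "\<And>f. infdist f (annihilator (insert x S))
      \<le> C * (infdist f (annihilator S) + \<bar>blinfun_apply f x\<bar>)"
    using infdist_annihilator_insert_le by blast
  have "((\<lambda>n. C * (infdist (z n) (annihilator S) + \<bar>z n x\<bar>)) \<longlongrightarrow> C * (0 + \<bar>0\<bar>)) F"
    using insert by (intro tendsto_intros) auto
  then have "((\<lambda>n. C * (infdist (z n) (annihilator S) + \<bar>z n x\<bar>)) \<longlongrightarrow> 0) F" by simp
  then show ?case
    by (rule tendsto_sandwich[OF always_eventually always_eventually tendsto_const, rotated 2])
      (simp_all add: C infdist_nonneg)
qed

lemma weak_star_nullI_annihilator:
  fixes y :: "nat \<Rightarrow> 'a::real_normed_vector \<Rightarrow>\<^sub>L real" and d :: "nat \<Rightarrow> 'a"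
  assumes dense: "closure (range d) = UNIV" and bound: "\<And>n. norm (y n) \<le> R"
    and annih: "\<And>m. \<forall>\<^sub>F n in sequentially. y n \<in> annihilator (d ` {..<m})"
  shows "weak_star_null y"
proof (rule weak_star_nullI_dense[OF dense bound])
  fix x assume "x \<in> range d"
  then obtain j where "x = d j" by blast
  then have "\<forall>\<^sub>F n in sequentially. y n x = 0"
    using annih[of "Suc j"] by (auto simp: annihilator_def elim: eventually_mono)
  then show "(\<lambda>n. y n x) \<longlonglongrightarrow> 0" by (rule tendsto_eventually)
qed

subsection \<open>Finite covers and finite families\<close>

definition finitely_covered :: "real \<Rightarrow> 'a::metric_space set \<Rightarrow> bool" where
  "finitely_covered e S \<longleftrightarrow> (\<exists>K. finite K \<and> S \<subseteq> (\<Union>k\<in>K. cball k e))"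

lemma finitely_covered_mono:
  assumes "finitely_covered e S" "T \<subseteq> S" "e \<le> e'"
  shows "finitely_covered e' T"
proof -
  obtain K where "finite K" "S \<subseteq> (\<Union>k\<in>K. cball k e)"
    using assms(1) unfolding finitely_covered_def by blast
  note \<open>T \<subseteq> S\<close>
  also note \<open>S \<subseteq> (\<Union>k\<in>K. cball k e)\<close>
  also have "(\<Union>k\<in>K. cball k e) \<subseteq> (\<Union>k\<in>K. cball k e')"
    using \<open>e \<le> e'\<close> by (intro UN_mono subset_cball) auto
  finally show ?thesis
    using \<open>finite K\<close> unfolding finitely_covered_def by blast
qed

lemma finitely_covered_UN:
  assumes "finite I" "\<And>i. i \<in> I \<Longrightarrow> finitely_covered e (S i)"
  shows "finitely_covered e (\<Union>i\<in>I. S i)"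
proof -
  obtain K where "\<And>i. i \<in> I \<Longrightarrow> finite (K i) \<and> S i \<subseteq> (\<Union>k\<in>K i. cball k e)"
    using assms(2) unfolding finitely_covered_def by metis
  then have "finite (\<Union>i\<in>I. K i)" "(\<Union>i\<in>I. S i) \<subseteq> (\<Union>k\<in>(\<Union>i\<in>I. K i). cball k e)"
    using assms(1) by blast+
  then show ?thesis unfolding finitely_covered_def by blast
qed

lemma finitely_covered_differences:
  fixes S T :: "'a::real_normed_vector set"
  assumes "finitely_covered a S" "finitely_covered b T"
  shows "finitely_covered (a + b) {x - y | x y. x \<in> S \<and> y \<in> T}"
proof -
  obtain K L where K: "finite K" "S \<subseteq> (\<Union>k\<in>K. cball k a)" and L: "finite L" "T \<subseteq> (\<Union>l\<in>L. cball l b)"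
    using assms unfolding finitely_covered_def by blast
  have "{x - y | x y. x \<in> S \<and> y \<in> T} \<subseteq> (\<Union>m\<in>(\<lambda>(k, l). k - l) ` (K \<times> L). cball m (a + b))"
  proof safe
    fix x y assume "x \<in> S" "y \<in> T"
    then obtain k l where "k \<in> K" "dist k x \<le> a" "l \<in> L" "dist l y \<le> b"
      using K(2) L(2) by fastforce
    then have "dist (k - l) (x - y) \<le> a + b"
      using norm_diff_triangle_ineq[of k x l y] norm_triangle_ineq4[of "k - x" "l - y"]
      by (simp add: dist_norm algebra_simps)
    with \<open>k \<in> K\<close> \<open>l \<in> L\<close> show "x - y \<in> (\<Union>m\<in>(\<lambda>(k, l). k - l) ` (K \<times> L). cball m (a + b))"
      by force
  qed
  moreover have "finite ((\<lambda>(k, l). k - l) ` (K \<times> L))" using K(1) L(1) by simp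
  ultimately show ?thesis unfolding finitely_covered_def by blast
qed

lemma finitely_covered_imp_inner_net:
  assumes "finitely_covered e S"
  shows "\<exists>F. finite F \<and> F \<subseteq> S \<and> S \<subseteq> (\<Union>u\<in>F. cball u (2 * e))"
proof -
  obtain K where K: "finite K" "S \<subseteq> (\<Union>k\<in>K. cball k e)"
    using assms unfolding finitely_covered_def by blast
  define L where "L = {k \<in> K. S \<inter> cball k e \<noteq> {}}"
  have "\<forall>k\<in>L. \<exists>y. y \<in> S \<inter> cball k e" by (auto simp: L_def)
  then obtain p where p: "\<And>k. k \<in> L \<Longrightarrow> p k \<in> S \<inter> cball k e" by metis
  have "S \<subseteq> (\<Union>u\<in>p ` L. cball u (2 * e))"
  proof
    fix x assume "x \<in> S"
    then obtain k where k: "k \<in> K" "x \<in> cball k e" using K(2) by blast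
    with \<open>x \<in> S\<close> have "k \<in> L" by (auto simp: L_def)
    moreover have "dist (p k) x \<le> 2 * e"
      using p[OF \<open>k \<in> L\<close>] k(2) dist_triangle3[of "p k" x k] by simp
    ultimately show "x \<in> (\<Union>u\<in>p ` L. cball u (2 * e))" by auto
  qed
  moreover have "finite (p ` L)" "p ` L \<subseteq> S" using K(1) p by (auto simp: L_def)
  ultimately show ?thesis by blast
qed

lemma finitely_coveredI_sequence:
  fixes S :: "'a::metric_space set"
  assumes close: "\<And>x :: nat \<Rightarrow> 'a. range x \<subseteq> S \<Longrightarrow> \<exists>i j. i < j \<and> dist (x i) (x j) \<le> e"
  shows "finitely_covered e S"
proof (rule ccontr)
  assume not_covered: "\<not> finitely_covered e S"
  let ?far = "\<lambda>x n y. y \<in> S \<and> (\<forall>i<(n::nat). dist (x i) y > e)"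
  have "\<exists>x. \<forall>n. ?far x n (x n)"
  proof (rule dependent_wellorder_choice)
    fix n :: nat and x :: "nat \<Rightarrow> 'a"
    have "\<not> S \<subseteq> (\<Union>k\<in>x ` {..<n}. cball k e)"
      using not_covered unfolding finitely_covered_def by blast
    then show "\<exists>y. ?far x n y" by (force simp: not_le)
  qed simp
  then obtain x :: "nat \<Rightarrow> 'a" where "range x \<subseteq> S"
    and far: "\<And>i j. i < j \<Longrightarrow> dist (x i) (x j) > e"
    by blast
  from close[OF this(1)] obtain i j where "i < j" "dist (x i) (x j) \<le> e" by blast
  with far[of i j] show False by simp
qed

lemma finite_family_enumeration:
  fixes F :: "nat \<Rightarrow> 'b set"
  assumes fin: "\<And>k. finite (F k)" and nonempty: "\<And>k. F k \<noteq> {}"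
  shows "\<exists>s :: nat \<Rightarrow> 'b. range s = (\<Union>k. F k) \<and>
    (\<forall>k. \<forall>\<^sub>F n in sequentially. s n \<in> (\<Union>i\<in>{k..}. F i))"
proof -
  define U where "U = (SIGMA k:UNIV. F k)"
  have "countable U"
    unfolding U_def using fin by (intro countable_SIGMA) (auto intro: countable_finite)
  moreover have "fst ` U = UNIV"
    using nonempty by (force simp: U_def image_iff)
  then have "infinite U"
    using finite_imageI[of U fst] by auto
  ultimately have bij: "bij_betw (from_nat_into U) UNIV U"
    by (rule bij_betw_from_nat_into)
  define s where "s n = snd (from_nat_into U n)" for n
  have "range s = snd ` range (from_nat_into U)"
    by (auto simp: s_def)
  also have "range (from_nat_into U) = U"
    using bij by (rule bij_betw_imp_surj_on)
  also have "snd ` U = (\<Union>k. F k)"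
    by (force simp: U_def)
  finally have "range s = (\<Union>k. F k)" .
  moreover have "\<forall>\<^sub>F n in sequentially. s n \<in> (\<Union>i\<in>{k..}. F i)" for k
  proof -
    have "finite (from_nat_into U -` (SIGMA i:{..<k}. F i))"
      using fin bij by (intro finite_vimageI finite_SigmaI) (auto simp: bij_betw_def)
    then have "\<forall>\<^sub>F n in sequentially. from_nat_into U n \<notin> (SIGMA i:{..<k}. F i)"
      by (simp add: eventually_cofinite vimage_def flip: cofinite_eq_sequentially)
    then show ?thesis
    proof eventually_elim
      case (elim n)
      moreover have "from_nat_into U n \<in> U"
        using bij_betwE[OF bij] by blast
      ultimately show ?case
        by (cases "from_nat_into U n") (auto simp: U_def s_def not_less)
    qed
  qed
  ultimately show ?thesis by blast
qed

subsection \<open>Embeddings into \<open>c\<^sub>0\<close>\<close>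

lemma c0_norm_le: "(\<And>n. \<bar>f n\<bar> \<le> B) \<Longrightarrow> c0_norm f \<le> B"
  unfolding c0_norm_def by (rule cSUP_least) auto

lemma abs_le_c0_norm:
  assumes "f \<in> c0"
  shows "\<bar>f n\<bar> \<le> c0_norm f"
proof -
  have "Bseq f"
    using assms by (auto simp: c0_def intro: convergent_imp_Bseq convergentI)
  then have "bdd_above (range (\<lambda>n. \<bar>f n\<bar>))"
    by (auto simp: Bseq_def intro: bdd_aboveI2)
  then show ?thesis
    unfolding c0_norm_def by (rule cSUP_upper[rotated]) simp
qed

lemma c0_norm_nonneg: "f \<in> c0 \<Longrightarrow> 0 \<le> c0_norm f"
  using abs_le_c0_norm[of f 0] by simp

lemma c0_diff: "f \<in> c0 \<Longrightarrow> g \<in> c0 \<Longrightarrow> (\<lambda>n. f n - g n) \<in> c0"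
  using tendsto_diff[of f 0 sequentially g 0] by (simp add: c0_def)

lemma c0_norm_minus_commute: "c0_norm (\<lambda>n. f n - g n) = c0_norm (\<lambda>n. g n - f n)"
  by (simp add: c0_norm_def abs_minus_commute)

lemma c0_norm_diff_triangle:
  assumes "f \<in> c0" "g \<in> c0" "h \<in> c0"
  shows "c0_norm (\<lambda>n. f n - h n) \<le> c0_norm (\<lambda>n. f n - g n) + c0_norm (\<lambda>n. g n - h n)"
proof (rule c0_norm_le)
  show "\<bar>f n - h n\<bar> \<le> c0_norm (\<lambda>n. f n - g n) + c0_norm (\<lambda>n. g n - h n)" for n
    using abs_le_c0_norm[OF c0_diff[OF assms(1,2)], of n]
      abs_le_c0_norm[OF c0_diff[OF assms(2,3)], of n] by linarith
qed

lemma linear_to_seq_diff: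
  assumes "linear_to_seq T"
  shows "T (x - y) = (\<lambda>n. T x n - T y n)"
proof -
  have "T (x - y) = (\<lambda>n. T x n + T ((- 1) *\<^sub>R y) n)"
    using assms unfolding linear_to_seq_def by (metis diff_conv_add_uminus scaleR_minus1_left)
  also have "T ((- 1) *\<^sub>R y) = (\<lambda>n. - 1 * T y n)"
    using assms unfolding linear_to_seq_def by blast
  finally show ?thesis by simp
qed

lemma linear_to_seq_zero: "linear_to_seq T \<Longrightarrow> T 0 = (\<lambda>n. 0)"
  using linear_to_seq_diff[of T 0 0] by simp

lemma c0_linear_subspace_range:
  assumes T: "linear_to_seq T" and "range T \<subseteq> c0"
  shows "c0_linear_subspace (range T)"
  unfolding c0_linear_subspace_def
proof (intro conjI ballI allI impI)
  show "(\<lambda>n. 0) \<in> range T"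
    using linear_to_seq_zero[OF T] by (metis rangeI)
  show "(\<lambda>n. f n + g n) \<in> range T" if fg: "f \<in> range T" "g \<in> range T" for f g
  proof -
    obtain x y where "f = T x" "g = T y" using fg by blast
    then have "(\<lambda>n. f n + g n) = T (x + y)" using T by (simp add: linear_to_seq_def)
    then show ?thesis by simp
  qed
  show "(\<lambda>n. a * f n) \<in> range T" if f: "f \<in> range T" for a f
  proof -
    obtain x where "f = T x" using f by blast
    then have "(\<lambda>n. a * f n) = T (a *\<^sub>R x)" using T by (simp add: linear_to_seq_def)
    then show ?thesis by simp
  qed
qed fact

locale c0_embedding =
  fixes T :: "'a::real_normed_vector \<Rightarrow> nat \<Rightarrow> real" and B K :: real
  assumes linear: "linear_to_seq T" and range_subset: "range T \<subseteq> c0"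
    and B_nonneg: "0 \<le> B" and upper: "\<And>x. c0_norm (T x) \<le> B * norm x"
    and K_nonneg: "0 \<le> K" and lower: "\<And>x. norm x \<le> K * c0_norm (T x)"
begin

lemma in_c0: "T x \<in> c0"
  using range_subset by blast

lemma inj: "inj T"
proof (rule injI)
  fix x y assume "T x = T y"
  then have "T (x - y) = (\<lambda>n. 0)"
    by (simp add: linear_to_seq_diff[OF linear])
  then have "norm (x - y) \<le> 0"
    using lower[of "x - y"] by (simp add: c0_norm_def)
  then show "x = y" by simp
qed

lemma bm_dist_c0_range_le: "bm_dist_c0 TYPE('a) (range T) \<le> ereal (B * K)"
proof -
  have "opnorm_to_c0 T \<le> ereal B"
    unfolding opnorm_to_c0_def
  proof (rule SUP_least)
    fix x :: 'a assume "x \<in> {x. norm x \<le> 1}"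
    then show "ereal (c0_norm (T x)) \<le> ereal B"
      using upper[of x] mult_left_le[of "norm x" B] B_nonneg by simp
  qed
  moreover have "opnorm_from_c0 (range T) (inv T) \<le> ereal K"
    unfolding opnorm_from_c0_def
  proof (rule SUP_least)
    fix y assume "y \<in> {y \<in> range T. c0_norm y \<le> 1}"
    then obtain x where "y = T x" "c0_norm (T x) \<le> 1" by blast
    then show "ereal (norm (inv T y)) \<le> ereal K"
      using lower[of x] mult_left_le[of "c0_norm (T x)" K] K_nonneg inj by simp
  qed
  moreover have "0 \<le> opnorm_from_c0 (range T) (inv T)"
    unfolding opnorm_from_c0_def
  proof (rule SUP_upper2)
    show "T 0 \<in> {y \<in> range T. c0_norm y \<le> 1}"
      using upper[of 0] by simp
  qed simp
  ultimately have "opnorm_to_c0 T * opnorm_from_c0 (range T) (inv T) \<le> ereal B * ereal K"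
    using B_nonneg by (intro ereal_mult_mono) auto
  moreover have "bm_dist_c0 TYPE('a) (range T) \<le> opnorm_to_c0 T * opnorm_from_c0 (range T) (inv T)"
    unfolding bm_dist_c0_def
    by (rule INF_lower) (simp add: linear inj bij_betw_def)
  ultimately show ?thesis by simp
qed

lemma dist_le_of_approximation:
  assumes "f \<in> c0"
  shows "dist x y \<le> K * c0_norm (\<lambda>n. T x n - f n) + K * c0_norm (\<lambda>n. T y n - f n)"
proof -
  have "c0_norm (T (x - y)) \<le> c0_norm (\<lambda>n. T x n - f n) + c0_norm (\<lambda>n. T y n - f n)"
    using c0_norm_diff_triangle[OF in_c0 assms in_c0, of x y]
    by (simp add: linear_to_seq_diff[OF linear] c0_norm_minus_commute[of f])
  then show ?thesis
    using lower[of "x - y"] mult_left_mono[OF _ K_nonneg]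
    by (fastforce simp: dist_norm distrib_left)
qed

end

lemma c0_closed_range:
  fixes T :: "'a::banach \<Rightarrow> nat \<Rightarrow> real"
  assumes "c0_embedding T B K"
  shows "c0_closed (range T)"
  unfolding c0_closed_def
proof (intro allI impI, elim conjE)
  interpret c0_embedding T B K by fact
  fix g f
  assume range: "\<forall>k. g k \<in> range T" and "f \<in> c0"
    and lim: "(\<lambda>k. c0_norm (\<lambda>n. g k n - f n)) \<longlonglongrightarrow> 0"
  have "\<forall>k. \<exists>x. g k = T x" using range by blast
  then obtain x where x: "\<And>k. g k = T (x k)" by metis
  define q where "q = (\<lambda>k. c0_norm (\<lambda>n. T (x k) n - f n))"
  have "q \<longlonglongrightarrow> 0" using lim by (simp add: q_def x)
  have "Cauchy x"
  proof (rule metric_CauchyI)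
    fix e :: real assume "e > 0"
    have "(\<lambda>k. K * q k) \<longlonglongrightarrow> 0" using \<open>q \<longlonglongrightarrow> 0\<close> by (rule tendsto_mult_right_zero)
    then have "\<forall>\<^sub>F k in sequentially. K * q k < e / 2"
      using \<open>e > 0\<close> by (intro order_tendstoD(2)) auto
    then obtain N where N: "\<And>k. k \<ge> N \<Longrightarrow> K * q k < e / 2"
      by (auto simp: eventually_sequentially)
    have "dist (x k) (x l) < e" if "k \<ge> N" "l \<ge> N" for k l
      using dist_le_of_approximation[OF \<open>f \<in> c0\<close>, of "x k" "x l"] N[OF that(1)] N[OF that(2)]
      by (simp add: q_def)
    then show "\<exists>M. \<forall>k\<ge>M. \<forall>l\<ge>M. dist (x k) (x l) < e" by blast
  qed
  then obtain y where "x \<longlonglongrightarrow> y"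
    using Cauchy_convergent convergent_def by blast
  have "c0_norm (\<lambda>n. T y n - f n) \<le> B * norm (y - x k) + q k" for k
    using c0_norm_diff_triangle[OF in_c0 in_c0 \<open>f \<in> c0\<close>, of y "x k"] upper[of "y - x k"]
    by (simp add: linear_to_seq_diff[OF linear] q_def)
  moreover have "(\<lambda>k. B * norm (y - x k) + q k) \<longlonglongrightarrow> B * norm (y - y) + 0"
    by (intro tendsto_intros \<open>x \<longlonglongrightarrow> y\<close> \<open>q \<longlonglongrightarrow> 0\<close>)
  ultimately have "c0_norm (\<lambda>n. T y n - f n) \<le> 0"
    by (intro LIMSEQ_le_const[of _ 0]) auto
  then have "T y n = f n" for n
    using abs_le_c0_norm[OF c0_diff[OF in_c0 \<open>f \<in> c0\<close>], of y n] by simp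
  then have "T y = f" ..
  then show "f \<in> range T" by blast
qed

definition evaluation :: "(nat \<Rightarrow> 'a::real_normed_vector \<Rightarrow>\<^sub>L real) \<Rightarrow> 'a \<Rightarrow> nat \<Rightarrow> real" where
  "evaluation \<phi> x = (\<lambda>n. \<phi> n x)"

lemma linear_to_seq_evaluation: "linear_to_seq (evaluation \<phi>)"
  by (simp add: linear_to_seq_def evaluation_def fun_eq_iff blinfun.add_right blinfun.scaleR_right)

lemma evaluation_in_c0: "weak_star_null \<phi> \<Longrightarrow> evaluation \<phi> x \<in> c0"
  by (simp add: weak_star_null_def c0_def evaluation_def)

lemma c0_norm_evaluation_le:
  assumes "\<And>n. norm (\<phi> n) \<le> R"
  shows "c0_norm (evaluation \<phi> x) \<le> R * norm x"
proof (rule c0_norm_le)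
  show "\<bar>evaluation \<phi> x n\<bar> \<le> R * norm x" for n
    using norm_blinfun_apply_le[OF assms[of n], of x] by (simp add: evaluation_def)
qed

lemma lipschitz_on_c0_norm_evaluation:
  assumes null: "weak_star_null \<phi>" and bound: "\<And>n. norm (\<phi> n) \<le> R"
  shows "R-lipschitz_on UNIV (\<lambda>x. c0_norm (evaluation \<phi> x))"
proof (rule lipschitz_onI)
  have c0_norm_diff_le: "c0_norm (evaluation \<phi> x) - c0_norm (evaluation \<phi> y) \<le> R * dist x y" for x y
  proof -
    have "(\<lambda>n. 0) \<in> c0" by (simp add: c0_def)
    then have "c0_norm (evaluation \<phi> x)
        \<le> c0_norm (\<lambda>n. evaluation \<phi> x n - evaluation \<phi> y n) + c0_norm (evaluation \<phi> y)"
      using c0_norm_diff_triangle[OF evaluation_in_c0[OF null] evaluation_in_c0[OF null]]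
      by fastforce
    also have "(\<lambda>n. evaluation \<phi> x n - evaluation \<phi> y n) = evaluation \<phi> (x - y)"
      by (rule linear_to_seq_diff[OF linear_to_seq_evaluation, symmetric])
    also have "c0_norm (evaluation \<phi> (x - y)) \<le> R * norm (x - y)"
      using bound by (rule c0_norm_evaluation_le)
    finally show ?thesis by (simp add: dist_norm)
  qed
  show "dist (c0_norm (evaluation \<phi> x)) (c0_norm (evaluation \<phi> y)) \<le> R * dist x y" for x y
    using c0_norm_diff_le[of x y] c0_norm_diff_le[of y x]
    by (simp add: dist_real_def dist_commute abs_le_iff)
  show "0 \<le> R" using bound[of 0] norm_ge_zero order_trans by blast
qed

lemma norm_le_c0_norm_evaluation_if_dense:
  fixes \<phi> :: "nat \<Rightarrow> 'a::real_normed_vector \<Rightarrow>\<^sub>L real"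
  assumes "weak_star_null \<phi>" "\<And>n. norm (\<phi> n) \<le> R" and dense: "closure D = UNIV"
    and lower: "\<And>x. x \<in> D \<Longrightarrow> norm x \<le> K * c0_norm (evaluation \<phi> x)"
  shows "norm x \<le> K * c0_norm (evaluation \<phi> x)"
proof -
  have "continuous_on UNIV (\<lambda>x. c0_norm (evaluation \<phi> x))"
    using lipschitz_on_c0_norm_evaluation[OF assms(1,2)] by (rule lipschitz_on_continuous_on)
  then have "closed {x. norm x \<le> K * c0_norm (evaluation \<phi> x)}"
    by (intro closed_Collect_le continuous_intros)
  then have "closure D \<subseteq> {x. norm x \<le> K * c0_norm (evaluation \<phi> x)}"
    using lower by (intro closure_minimal) auto
  with dense show ?thesis by blast
qed

lemma c0_embedding_evaluation:
  assumes "weak_star_null \<phi>" "\<And>n. norm (\<phi> n) \<le> R" "0 \<le> K"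
    and "\<And>x. norm x \<le> K * c0_norm (evaluation \<phi> x)"
  shows "c0_embedding (evaluation \<phi>) R K"
proof
  show "0 \<le> R" using assms(2)[of 0] norm_ge_zero order_trans by blast
qed (use assms in \<open>auto intro: linear_to_seq_evaluation evaluation_in_c0 c0_norm_evaluation_le\<close>)

lemma abs_apply_le_norm_times_c0_norm_evaluation:
  assumes "weak_star_null \<phi>" "sgn u \<in> range \<phi>"
  shows "\<bar>blinfun_apply u x\<bar> \<le> norm u * c0_norm (evaluation \<phi> x)"
proof -
  obtain i where "\<phi> i = sgn u" using assms(2) by (metis imageE)
  then have "norm u * \<bar>evaluation \<phi> x i\<bar> = \<bar>u x\<bar>"
    by (cases "u = 0") (simp_all add: evaluation_def sgn_div_norm blinfun.scaleR_left abs_mult)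
  then show ?thesis
    using mult_left_mono[OF abs_le_c0_norm[OF evaluation_in_c0[OF assms(1)]] norm_ge_zero[of u]]
    by metis
qed

subsection \<open>Kadec--Klee estimates\<close>

definition LKK_estimate :: "real \<Rightarrow> real \<Rightarrow> 'a::real_normed_vector \<Rightarrow> 'a \<Rightarrow> bool" where
  "LKK_estimate c \<delta> h y \<longleftrightarrow> norm h + c * norm y \<le> norm (h + y) + \<delta>"

lemma LKK_estimate_perturb:
  assumes "LKK_estimate c \<delta> k y" "dist k h \<le> e"
  shows "LKK_estimate c (\<delta> + 2 * e) h y"
proof -
  have "norm h \<le> norm k + e"
    using norm_triangle_ineq2[of h k] assms(2) by (simp add: dist_norm norm_minus_commute)
  moreover have "norm (k + y) \<le> norm (h + y) + e"
    using norm_triangle_ineq2[of "k + y" "h + y"] assms(2) by (simp add: dist_norm)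
  ultimately show ?thesis using assms(1) by (simp add: LKK_estimate_def)
qed

lemma LKK_star_eventually_estimate:
  fixes f :: "'a::real_normed_vector \<Rightarrow>\<^sub>L real"
  assumes LKK: "c_LKK_star c TYPE('a)" and "0 \<le> c" and "weak_star_null z"
    and bound: "\<And>n. norm (z n) \<le> R" and "\<delta> > 0"
  shows "\<forall>\<^sub>F n in sequentially. LKK_estimate c \<delta> f (z n)"
proof (rule ccontr)
  assume "\<not> ?thesis"
  then obtain r :: "nat \<Rightarrow> nat" where "strict_mono r"
    and violation: "\<And>n. \<not> LKK_estimate c \<delta> f (z (r n))"
    using not_eventually_sequentiallyD[of "\<lambda>n. LKK_estimate c \<delta> f (z n)"] by blast
  define w where "w = z \<circ> r"
  have "weak_star_null w"
    unfolding w_def by (rule weak_star_null_subseq) fact+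
  let ?L = "limsup (\<lambda>n. ereal (norm (w n)))"
  have "0 \<le> ?L"
    by (intro le_Limsup) auto
  moreover have "?L \<le> ereal R"
    by (intro Limsup_bounded) (use bound in \<open>auto simp: w_def\<close>)
  ultimately obtain l where l: "?L = ereal l"
    by (cases ?L) auto
  have "ereal (norm f) + ereal c * ?L \<le> limsup (\<lambda>n. ereal (norm (f + w n)))"
    using LKK \<open>weak_star_null w\<close> unfolding c_LKK_star_def by blast
  also have "\<dots> \<le> limsup (\<lambda>n. ereal (norm f - \<delta>) + ereal c * ereal (norm (w n)))"
  proof (intro Limsup_mono always_eventually allI)
    show "ereal (norm (f + w n)) \<le> ereal (norm f - \<delta>) + ereal c * ereal (norm (w n))" for n
      using violation[of n] by (simp add: LKK_estimate_def w_def)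
  qed
  also have "\<dots> = ereal (norm f - \<delta>) + ereal c * ?L"
    using \<open>0 \<le> c\<close> by (simp add: Limsup_add_ereal_left limsup_ereal_mult_left del: times_ereal.simps)
  finally show False
    using \<open>\<delta> > 0\<close> by (simp add: l)
qed

lemma exists_small_increment:
  fixes \<rho> :: "nat \<Rightarrow> real"
  assumes "\<rho> N - \<rho> 0 < real N * \<theta>"
  shows "\<exists>k<N. \<rho> (Suc k) < \<rho> k + \<theta>"
proof (rule ccontr)
  assume "\<not> ?thesis"
  then have "\<rho> k + \<theta> \<le> \<rho> (Suc k)" if "k < N" for k
    using that by (meson not_le)
  then have "(\<Sum>k<N. \<theta>) \<le> (\<Sum>k<N. \<rho> (Suc k) - \<rho> k)"
    by (intro sum_mono) (simp add: algebra_simps)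
  then show False
    using assms by (simp add: sum_lessThan_telescope)
qed

lemma exists_perturbation_constant:
  assumes "0 < b" "0 < \<epsilon>"
  shows "\<exists>\<tau>::real. 0 < \<tau> \<and> \<tau> < 1 \<and> (1 + \<tau>) * b + \<tau> = (1 - \<tau>) * (b + \<epsilon>)"
proof -
  define \<tau> where "\<tau> = \<epsilon> / (2 * b + 1 + \<epsilon>)"
  have "\<tau> * (2 * b + 1 + \<epsilon>) = \<epsilon>" using assms by (simp add: \<tau>_def)
  then have "(1 + \<tau>) * b + \<tau> = (1 - \<tau>) * (b + \<epsilon>)" by (simp add: algebra_simps)
  moreover have "0 < \<tau>" "\<tau> < 1" using assms by (auto simp: \<tau>_def)
  ultimately show ?thesis by blast
qed

subsection \<open>Approximating functionals along a chain of annihilators\<close>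

locale LKK_star =
  fixes c :: real and d :: "nat \<Rightarrow> 'a::real_normed_vector"
  assumes LKK: "c_LKK_star c TYPE('a)" and c_pos: "0 < c" and dense: "closure (range d) = UNIV"
begin

abbreviation A :: "nat \<Rightarrow> ('a \<Rightarrow>\<^sub>L real) set" where
  "A m \<equiv> annihilator (d ` {..<m})"

lemma A_antimono: "m \<le> n \<Longrightarrow> A n \<subseteq> A m"
  by (intro annihilator_antimono image_mono) auto

lemma estimate_on_annihilator:
  assumes "\<delta> > 0"
  shows "\<exists>m. \<forall>y\<in>A m. norm y \<le> R \<longrightarrow> LKK_estimate c \<delta> h y"
proof (rule ccontr)
  assume "\<not> ?thesis"
  then obtain y where y: "\<And>m. y m \<in> A m" "\<And>m. norm (y m) \<le> R" "\<And>m. \<not> LKK_estimate c \<delta> h (y m)"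
    by metis
  have "\<forall>\<^sub>F n in sequentially. y n \<in> A m" for m
    using y(1) A_antimono by (intro eventually_sequentiallyI[of m]) blast
  then have "weak_star_null y"
    by (rule weak_star_nullI_annihilator[OF dense y(2)])
  then have "\<forall>\<^sub>F n in sequentially. LKK_estimate c \<delta> h (y n)"
    using LKK_star_eventually_estimate[OF LKK _ _ y(2) \<open>\<delta> > 0\<close>] c_pos by simp
  with y(3) show False by simp
qed

lemma uniform_estimate_on_annihilator:
  assumes "finitely_covered e S" "\<delta> > 0"
  shows "\<exists>m>k. \<forall>h\<in>S. \<forall>y\<in>A m. norm y \<le> R \<longrightarrow> LKK_estimate c (\<delta> + 2 * e) h y"
proof -
  obtain K where K: "finite K" "S \<subseteq> (\<Union>h\<in>K. cball h e)"
    using assms(1) unfolding finitely_covered_def by blast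
  obtain p where p: "\<And>h y. y \<in> A (p h) \<Longrightarrow> norm y \<le> R \<Longrightarrow> LKK_estimate c \<delta> h y"
    using estimate_on_annihilator[OF \<open>\<delta> > 0\<close>] by metis
  define m where "m = Max (insert (Suc k) (p ` K))"
  have "Suc k \<le> m"
    unfolding m_def using K(1) by (intro Max_ge) auto
  moreover have "LKK_estimate c (\<delta> + 2 * e) h y" if "h \<in> S" "y \<in> A m" "norm y \<le> R" for h y
  proof -
    obtain h' where h': "h' \<in> K" "dist h' h \<le> e"
      using K(2) \<open>h \<in> S\<close> by (auto simp: subset_iff)
    then have "p h' \<le> m"
      unfolding m_def using K(1) by (intro Max_ge) auto
    then have "LKK_estimate c \<delta> h' y"
      using p A_antimono that(2,3) by blast
    then show ?thesis
      using h'(2) by (rule LKK_estimate_perturb)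
  qed
  ultimately show ?thesis
    unfolding Suc_le_eq by blast
qed

definition near_minimal :: "real \<Rightarrow> real \<Rightarrow> nat \<Rightarrow> ('a \<Rightarrow>\<^sub>L real) set" where
  "near_minimal R \<theta> m = {h. norm h \<le> R \<and> norm h \<le> infdist h (A m) + \<theta>}"

text \<open>In the limit along a weak-star convergent sequence the distance to \<^term>\<open>A m\<close> is at most the
  norm of the limit \<open>g\<close>, so a near-minimal sequence leaves no room for a large deviation from \<open>g\<close>.\<close>

lemma finitely_covered_near_minimal:
  assumes "2 * \<theta> < c * e"
  shows "finitely_covered e (near_minimal R \<theta> m)"
proof (rule finitely_coveredI_sequence)
  fix x :: "nat \<Rightarrow> 'a \<Rightarrow>\<^sub>L real"
  assume "range x \<subseteq> near_minimal R \<theta> m"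
  then have bound: "norm (x n) \<le> R" and minimal: "norm (x n) \<le> infdist (x n) (A m) + \<theta>" for n
    by (auto simp: near_minimal_def)
  obtain r g where r: "strict_mono r" and null: "weak_star_null (\<lambda>n. x (r n) - g)"
    by (rule sequential_Banach_Alaoglu[OF dense bound])
  define z where "z n = x (r n) - g" for n
  define \<delta> where "\<delta> = (c * e - 2 * \<theta>) / 4"
  have "\<delta> > 0" using assms by (simp add: \<delta>_def)
  have z_bound: "norm (z n) \<le> R + norm g" for n
    using norm_triangle_ineq4[of "x (r n)" g] bound[of "r n"] by (simp add: z_def)
  have "\<forall>\<^sub>F n in sequentially. LKK_estimate c \<delta> g (z n)"
    using LKK_star_eventually_estimate[OF LKK _ _ z_bound \<open>\<delta> > 0\<close>] c_pos null by (simp add: z_def)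
  moreover have "(\<lambda>n. infdist (z n) (A m)) \<longlonglongrightarrow> 0"
    using null by (intro infdist_annihilator_tendsto_0) (auto simp: z_def weak_star_null_def)
  then have "\<forall>\<^sub>F n in sequentially. infdist (z n) (A m) < \<delta>"
    using \<open>\<delta> > 0\<close> by (rule order_tendstoD(2))
  ultimately have "\<forall>\<^sub>F n in sequentially. norm (z n) < e / 2"
  proof eventually_elim
    case (elim n)
    have "norm g + c * norm (z n) \<le> norm (x (r n)) + \<delta>"
      using elim(1) by (simp add: LKK_estimate_def z_def)
    also have "norm (x (r n)) \<le> infdist (z n) (A m) + norm g + \<theta>"
      using minimal[of "r n"] infdist_triangle[of "x (r n)" "A m" "z n"]
      by (simp add: z_def dist_norm)
    finally have "c * norm (z n) < c * (e / 2)"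
      using elim(2) by (simp add: \<delta>_def field_simps)
    then show ?case using c_pos by simp
  qed
  then obtain N where N: "\<And>n. n \<ge> N \<Longrightarrow> norm (z n) < e / 2"
    by (auto simp: eventually_sequentially)
  have "dist (x (r N)) (x (r (Suc N))) \<le> e"
    using norm_triangle_ineq4[of "z N" "z (Suc N)"] N[of N] N[of "Suc N"]
    by (simp add: z_def dist_norm)
  moreover have "r N < r (Suc N)" using r by (simp add: strict_mono_def)
  ultimately show "\<exists>i j. i < j \<and> dist (x i) (x j) \<le> e" by blast
qed

lemma near_minimal_representative:
  assumes "norm f \<le> 1" "m \<le> p" "infdist f (A p) < infdist f (A m) + \<theta>"
  shows "\<exists>g\<in>near_minimal 2 \<theta> m. g - f \<in> A p"
proof -
  have "infdist f (A p) < 2"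
    using infdist_subspace_le_norm[OF subspace_annihilator, of f] \<open>norm f \<le> 1\<close> by (smt (verit))
  with assms(3) have "setdist {f} (A p) < min 2 (infdist f (A m) + \<theta>)"
    by (simp add: infdist_eq_setdist)
  then obtain v where v: "v \<in> A p" "norm (f - v) < min 2 (infdist f (A m) + \<theta>)"
    using subspace_0[OF subspace_annihilator] by (elim setdist_ltE) (auto simp: dist_norm)
  have "infdist (f - v) (A m) = infdist f (A m)"
    using v(1) A_antimono[OF \<open>m \<le> p\<close>] by (intro infdist_diff_subspace subspace_annihilator) blast
  with v(2) have "f - v \<in> near_minimal 2 \<theta> m"
    by (simp add: near_minimal_def)
  moreover have "(f - v) - f \<in> A p"
    using subspace_neg[OF subspace_annihilator v(1)] by simp
  ultimately show ?thesis by blast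
qed

lemma near_minimal_estimates:
  assumes "\<eta> > 0"
  shows "\<exists>\<theta>>0. \<forall>i. finitely_covered \<eta> (near_minimal 2 \<theta> i) \<and>
    (\<exists>p>i. \<forall>h\<in>near_minimal 2 \<theta> i. \<forall>y\<in>A p. norm y \<le> 4 \<longrightarrow> LKK_estimate c \<eta> h y)"
proof -
  define \<theta> where "\<theta> = c * \<eta> / 16"
  have "\<theta> > 0" "2 * \<theta> < c * (\<eta> / 4)"
    using c_pos assms by (auto simp: \<theta>_def)
  then have cover: "finitely_covered (\<eta> / 4) (near_minimal 2 \<theta> i)" for i
    by (intro finitely_covered_near_minimal)
  have "finitely_covered \<eta> (near_minimal 2 \<theta> i)" for i
    using cover by (rule finitely_covered_mono) (use assms in auto)
  moreover have "\<exists>p>i. \<forall>h\<in>near_minimal 2 \<theta> i. \<forall>y\<in>A p. norm y \<le> 4 \<longrightarrow> LKK_estimate c \<eta> h y" for i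
    using uniform_estimate_on_annihilator[OF cover, of "\<eta> / 2"] assms by simp
  ultimately show ?thesis using \<open>\<theta> > 0\<close> by blast
qed

definition anchors :: "real \<Rightarrow> nat \<Rightarrow> nat \<Rightarrow> ('a \<Rightarrow>\<^sub>L real) \<Rightarrow> ('a \<Rightarrow>\<^sub>L real) set" where
  "anchors \<eta> m M f = {g. norm g \<le> 2 \<and> g - f \<in> A m \<and>
     (\<forall>z. norm z \<le> 2 \<longrightarrow> z - f \<in> A M \<longrightarrow> LKK_estimate c \<eta> g (z - g))}"

lemma anchorsI:
  assumes "norm g \<le> 2" "g - f \<in> A p" "m \<le> p" "p \<le> M"
    and estimate: "\<And>y. y \<in> A p \<Longrightarrow> norm y \<le> 4 \<Longrightarrow> LKK_estimate c \<eta> g y"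
  shows "g \<in> anchors \<eta> m M f"
proof -
  have "LKK_estimate c \<eta> g (z - g)" if "norm z \<le> 2" "z - f \<in> A M" for z
  proof (rule estimate)
    have "z - f \<in> A p"
      using that(2) A_antimono[OF \<open>p \<le> M\<close>] by blast
    then have "(z - f) - (g - f) \<in> A p"
      using assms(2) by (rule subspace_diff[OF subspace_annihilator])
    then show "z - g \<in> A p" by simp
    show "norm (z - g) \<le> 4"
      using norm_triangle_ineq4[of z g] \<open>norm z \<le> 2\<close> \<open>norm g \<le> 2\<close> by simp
  qed
  then show ?thesis
    using assms(1,2) A_antimono[OF \<open>m \<le> p\<close>] by (auto simp: anchors_def)
qed

lemma norm_anchor_le:
  assumes "norm f \<le> 1" "g \<in> anchors \<eta> m M f"
  shows "norm g \<le> 1 + \<eta>"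
proof -
  have "f - f \<in> A M" by (simp add: annihilator_def)
  then have "LKK_estimate c \<eta> g (f - g)"
    using assms unfolding anchors_def by (smt (verit) mem_Collect_eq)
  moreover have "0 \<le> c * norm (f - g)" using c_pos by simp
  ultimately show ?thesis using \<open>norm f \<le> 1\<close> by (simp add: LKK_estimate_def)
qed

text \<open>Along a long enough chain of annihilators the distances of \<open>f\<close> to two consecutive members
  \<open>A i \<supseteq> A p\<close> almost coincide; a nearly norm-minimal \<open>g \<in> f + A p\<close> is then nearly minimal
  modulo \<open>A i\<close> as well, hence lies in a set that depends on \<open>i\<close> only and is finitely covered.\<close>

lemma finitely_covered_anchors:
  assumes "\<eta> > 0"
  shows "\<exists>M>m. \<exists>G. finitely_covered \<eta> G \<and> (\<forall>f. norm f \<le> 1 \<longrightarrow> G \<inter> anchors \<eta> m M f \<noteq> {})"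
proof -
  obtain \<theta> where "\<theta> > 0" and cover: "\<And>i. finitely_covered \<eta> (near_minimal 2 \<theta> i)"
    and "\<And>i. \<exists>p>i. \<forall>h\<in>near_minimal 2 \<theta> i. \<forall>y\<in>A p. norm y \<le> 4 \<longrightarrow> LKK_estimate c \<eta> h y"
    using near_minimal_estimates[OF assms] by blast
  then obtain s where s: "\<And>i. i < s i" and estimate: "\<And>i h y. h \<in> near_minimal 2 \<theta> i \<Longrightarrow>
      y \<in> A (s i) \<Longrightarrow> norm y \<le> 4 \<Longrightarrow> LKK_estimate c \<eta> h y"
    by metis
  define a where "a k = (s ^^ k) m" for k
  have a_0: "a 0 = m" and a_Suc: "a (Suc k) = s (a k)" for k by (simp_all add: a_def)
  have "strict_mono a" using s by (simp add: strict_mono_Suc_iff a_Suc)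
  obtain N where N: "1 < real N * \<theta>"
    using reals_Archimedean3[OF \<open>\<theta> > 0\<close>] by blast
  define G where "G = (\<Union>k<N. near_minimal 2 \<theta> (a k))"
  have "G \<inter> anchors \<eta> m (a N) f \<noteq> {}" if "norm f \<le> 1" for f
  proof -
    have "infdist f (A (a N)) - infdist f (A (a 0)) < real N * \<theta>"
      using N \<open>norm f \<le> 1\<close> infdist_subspace_le_norm[OF subspace_annihilator, of f]
      by (smt (verit) infdist_nonneg)
    then obtain k where "k < N" and "infdist f (A (a (Suc k))) < infdist f (A (a k)) + \<theta>"
      using exists_small_increment[of "\<lambda>k. infdist f (A (a k))"] by blast
    then obtain g where g: "g \<in> near_minimal 2 \<theta> (a k)" "g - f \<in> A (a (Suc k))"
      using near_minimal_representative[OF \<open>norm f \<le> 1\<close>] \<open>strict_mono a\<close>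
      by (metis lessI order_less_imp_le strict_monoD)
    have "g \<in> anchors \<eta> m (a N) f"
    proof (rule anchorsI[OF _ g(2)])
      show "norm g \<le> 2" using g(1) by (simp add: near_minimal_def)
      show "m \<le> a (Suc k)" "a (Suc k) \<le> a N"
        using \<open>strict_mono a\<close> \<open>k < N\<close> a_0 by (metis strict_mono_less_eq Suc_leI le0)+
      show "LKK_estimate c \<eta> g y" if "y \<in> A (a (Suc k))" "norm y \<le> 4" for y
        using estimate[OF g(1)] that by (simp add: a_Suc)
    qed
    with g(1) \<open>k < N\<close> show ?thesis by (auto simp: G_def)
  qed
  moreover have "finitely_covered \<eta> G"
    unfolding G_def by (intro finitely_covered_UN cover) simp
  moreover have "N > 0" using N by (cases N) auto
  then have "m < a N" using \<open>strict_mono a\<close> a_0 by (metis strict_monoD)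
  ultimately show ?thesis by blast
qed

definition LKK_chain :: "(nat \<Rightarrow> real) \<Rightarrow> ('a \<Rightarrow>\<^sub>L real) \<Rightarrow> (nat \<Rightarrow> 'a \<Rightarrow>\<^sub>L real) \<Rightarrow> bool" where
  "LKK_chain \<eta> f g \<longleftrightarrow> g 0 = 0 \<and> (\<forall>k. g k - f \<in> A k \<and> norm (g k) \<le> 1 + \<eta> k \<and>
     LKK_estimate c (\<eta> k) (g k) (g (Suc k) - g k))"

lemma LKK_chain_increment:
  assumes "LKK_chain \<eta> f g"
  shows "g (Suc k) - g k \<in> A k"
proof -
  have "g (Suc k) - f \<in> A k" "g k - f \<in> A k"
    using assms A_antimono[of k "Suc k"] unfolding LKK_chain_def by auto
  then have "(g (Suc k) - f) - (g k - f) \<in> A k"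
    by (rule subspace_diff[OF subspace_annihilator])
  then show ?thesis by simp
qed

lemma LKK_chain_variation_le:
  assumes "LKK_chain \<eta> f g"
  shows "c * (\<Sum>k<n. norm (g (Suc k) - g k)) \<le> 1 + (\<Sum>k\<le>n. \<eta> k)"
proof -
  have "LKK_estimate c (\<eta> k) (g k) (g (Suc k) - g k)" for k
    using assms by (simp add: LKK_chain_def)
  then have "c * norm (g (Suc k) - g k) \<le> (norm (g (Suc k)) - norm (g k)) + \<eta> k" for k
    by (simp add: LKK_estimate_def algebra_simps)
  then have "c * (\<Sum>k<n. norm (g (Suc k) - g k))
      \<le> (\<Sum>k<n. (norm (g (Suc k)) - norm (g k)) + \<eta> k)"
    unfolding sum_distrib_left by (intro sum_mono)
  also have "\<dots> = norm (g n) + (\<Sum>k<n. \<eta> k)"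
    using assms sum_lessThan_telescope[of "\<lambda>k. norm (g k)" n]
    by (simp add: sum.distrib LKK_chain_def)
  also have "norm (g n) \<le> 1 + \<eta> n"
    using assms by (simp add: LKK_chain_def)
  finally show ?thesis by (simp flip: lessThan_Suc_atMost)
qed

lemma LKK_chain_perturbation_variation_le:
  assumes "LKK_chain \<eta> f g"
  shows "(\<Sum>k<n. norm (u k))
    \<le> (1 + (\<Sum>k\<le>n. \<eta> k)) / c + (\<Sum>k<n. norm (g (Suc k) - g k - u k))"
proof -
  have "(\<Sum>k<n. norm (u k))
      \<le> (\<Sum>k<n. norm (g (Suc k) - g k) + norm (g (Suc k) - g k - u k))"
    by (intro sum_mono) (metis norm_minus_commute norm_triangle_sub)
  also have "\<dots> = (\<Sum>k<n. norm (g (Suc k) - g k)) + (\<Sum>k<n. norm (g (Suc k) - g k - u k))"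
    by (rule sum.distrib)
  also have "(\<Sum>k<n. norm (g (Suc k) - g k)) \<le> (1 + (\<Sum>k\<le>n. \<eta> k)) / c"
    using LKK_chain_variation_le[OF assms, of n] c_pos by (simp add: field_simps)
  finally show ?thesis by simp
qed

lemma LKK_chain_perturbation_infdist_le:
  assumes "LKK_chain \<eta> f g"
  shows "infdist (f - (\<Sum>k<n. u k)) (A n) \<le> (\<Sum>k<n. norm (g (Suc k) - g k - u k))"
proof (rule infdist_le2)
  show "f - g n \<in> A n"
    using assms subspace_neg[OF subspace_annihilator, of "g n - f"] by (simp add: LKK_chain_def)
  have "(\<Sum>k<n. g (Suc k) - g k) = g n"
    using assms by (simp add: sum_lessThan_telescope LKK_chain_def)
  then have "dist (f - (\<Sum>k<n. u k)) (f - g n) = norm (\<Sum>k<n. g (Suc k) - g k - u k)"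
    by (simp add: dist_norm sum_subtractf)
  also have "\<dots> \<le> (\<Sum>k<n. norm (g (Suc k) - g k - u k))"
    by (rule norm_sum)
  finally show "dist (f - (\<Sum>k<n. u k)) (f - g n) \<le> (\<Sum>k<n. norm (g (Suc k) - g k - u k))" .
qed

lemma LKK_chain_of_anchors:
  assumes "c \<le> 1" "norm f \<le> 1" and \<eta>_pos: "\<And>k. \<eta> k > 0" and le_m: "\<And>k. k \<le> m k"
    and h: "\<And>k. h k \<in> anchors (\<eta> k) (m k) (m (Suc k)) f"
  shows "LKK_chain \<eta> f (h(0 := 0))"
proof -
  let ?g = "h(0 := 0)"
  have "?g k - f \<in> A k" for k
    using h[of k] A_antimono[OF le_m[of k]] by (auto simp: anchors_def annihilator_def)
  moreover have "norm (?g k) \<le> 1 + \<eta> k" for k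
    using norm_anchor_le[OF \<open>norm f \<le> 1\<close> h] \<eta>_pos[of k] by (auto simp: less_imp_le)
  moreover have "LKK_estimate c (\<eta> k) (?g k) (?g (Suc k) - ?g k)" for k
  proof (cases "k = 0")
    case True
    then show ?thesis
      using \<eta>_pos[of 0] mult_right_mono[OF \<open>c \<le> 1\<close> norm_ge_zero[of "h (Suc 0)"]]
      by (simp add: LKK_estimate_def)
  next
    case False
    then show ?thesis
      using h[of k] h[of "Suc k"] by (simp add: anchors_def)
  qed
  ultimately show ?thesis by (simp add: LKK_chain_def)
qed

lemma finitely_covered_chains:
  assumes "c \<le> 1" and \<eta>_pos: "\<And>k. \<eta> k > 0"
  shows "\<exists>G. (\<forall>k. finitely_covered (\<eta> k) (G k)) \<and>
    (\<forall>f. norm f \<le> 1 \<longrightarrow> (\<exists>g. LKK_chain \<eta> f g \<and> (\<forall>k. g k \<in> G k)))"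
proof -
  have "\<exists>M G. i < M \<and> finitely_covered (\<eta> k) G \<and>
      (\<forall>f. norm f \<le> 1 \<longrightarrow> G \<inter> anchors (\<eta> k) i M f \<noteq> {})" for i k
    using finitely_covered_anchors[of "\<eta> k" i] \<eta>_pos[of k] by blast
  then obtain M H where M: "\<And>i k. i < M i k" and H: "\<And>i k. finitely_covered (\<eta> k) (H i k)"
    and anchor: "\<And>i k f. norm f \<le> 1 \<Longrightarrow> H i k \<inter> anchors (\<eta> k) i (M i k) f \<noteq> {}"
    by metis
  define m where "m = rec_nat 0 (\<lambda>k i. M i k)"
  have m_Suc: "m (Suc k) = M (m k) k" for k by (simp add: m_def)
  then have "strict_mono m" using M by (simp add: strict_mono_Suc_iff)
  then have le_m: "k \<le> m k" for k by (rule strict_mono_imp_increasing)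
  define G where "G = (\<lambda>k. H (m k) k)(0 := {0})"
  have "\<exists>g. LKK_chain \<eta> f g \<and> (\<forall>k. g k \<in> G k)" if f: "norm f \<le> 1" for f
  proof -
    have "\<exists>h. h \<in> H (m k) k \<and> h \<in> anchors (\<eta> k) (m k) (m (Suc k)) f" for k
      using anchor[OF f, of "m k" k] by (auto simp: m_Suc)
    then obtain h where "\<And>k. h k \<in> H (m k) k"
      and h: "\<And>k. h k \<in> anchors (\<eta> k) (m k) (m (Suc k)) f"
      by metis
    then have "(h(0 := 0)) k \<in> G k" for k by (simp add: G_def)
    then show ?thesis
      using LKK_chain_of_anchors[OF \<open>c \<le> 1\<close> f \<eta>_pos le_m h] by blast
  qed
  moreover have "finitely_covered (\<eta> k) (G k)" for k
    using H \<eta>_pos[of k] by (auto simp: G_def finitely_covered_def intro!: exI[of _ "{0}"])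
  ultimately show ?thesis by blast
qed

lemma finite_increment_nets:
  assumes "c \<le> 1" and \<eta>_pos: "\<And>k. \<eta> k > 0"
  shows "\<exists>F. (\<forall>k. finite (F k) \<and> F k \<subseteq> A k) \<and> (\<forall>f. norm f \<le> 1 \<longrightarrow> (\<exists>g u. LKK_chain \<eta> f g \<and>
    (\<forall>k. u k \<in> F k \<and> dist (u k) (g (Suc k) - g k) \<le> 2 * (\<eta> (Suc k) + \<eta> k))))"
proof -
  obtain G where G: "\<And>k. finitely_covered (\<eta> k) (G k)"
    and chain: "\<And>f. norm f \<le> 1 \<Longrightarrow> \<exists>g. LKK_chain \<eta> f g \<and> (\<forall>k. g k \<in> G k)"
    using finitely_covered_chains[OF \<open>c \<le> 1\<close>, of \<eta>] \<eta>_pos by blast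
  define D where "D k = A k \<inter> {x - y | x y. x \<in> G (Suc k) \<and> y \<in> G k}" for k
  have "finitely_covered (\<eta> (Suc k) + \<eta> k) (D k)" for k
    using finitely_covered_differences[OF G G] by (rule finitely_covered_mono) (auto simp: D_def)
  then have "\<exists>F. finite F \<and> F \<subseteq> D k \<and> D k \<subseteq> (\<Union>u\<in>F. cball u (2 * (\<eta> (Suc k) + \<eta> k)))" for k
    by (rule finitely_covered_imp_inner_net)
  then obtain F where F: "\<And>k. finite (F k)" "\<And>k. F k \<subseteq> D k"
    and net: "\<And>k. D k \<subseteq> (\<Union>u\<in>F k. cball u (2 * (\<eta> (Suc k) + \<eta> k)))"
    by metis
  have "\<exists>g u. LKK_chain \<eta> f g \<and>
      (\<forall>k. u k \<in> F k \<and> dist (u k) (g (Suc k) - g k) \<le> 2 * (\<eta> (Suc k) + \<eta> k))"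
    if "norm f \<le> 1" for f
  proof -
    obtain g where g: "LKK_chain \<eta> f g" "\<And>k. g k \<in> G k"
      using chain[OF \<open>norm f \<le> 1\<close>] by blast
    then have "g (Suc k) - g k \<in> D k" for k
      using LKK_chain_increment by (auto simp: D_def)
    then have "\<forall>k. \<exists>u\<in>F k. dist u (g (Suc k) - g k) \<le> 2 * (\<eta> (Suc k) + \<eta> k)"
      using net by (fastforce simp: subset_iff)
    with g(1) show ?thesis by metis
  qed
  moreover have "F k \<subseteq> A k" for k using F(2)[of k] by (auto simp: D_def)
  ultimately show ?thesis using F(1) by blast
qed

lemma dual_ball_decomposition:
  assumes "c \<le> 1" "\<tau> > 0"
  shows "\<exists>F. (\<forall>k. finite (F k) \<and> F k \<subseteq> A k) \<and> (\<forall>f. norm f \<le> 1 \<longrightarrow> (\<exists>u. (\<forall>k. u k \<in> F k) \<and>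
    (\<forall>n. (\<Sum>k<n. norm (u k)) \<le> (1 + \<tau>) / c + \<tau> \<and> infdist (f - (\<Sum>k<n. u k)) (A n) \<le> \<tau>)))"
proof -
  define \<eta> where "\<eta> k = \<tau> / 4 * (1 / 2) ^ Suc k" for k :: nat
  have \<eta>_pos: "\<eta> k > 0" and \<eta>_antimono: "\<eta> (Suc k) \<le> \<eta> k" for k
    using \<open>\<tau> > 0\<close> by (simp_all add: \<eta>_def)
  have "\<eta> sums (\<tau> / 4)"
    unfolding \<eta>_def using sums_mult[OF power_half_series, of "\<tau> / 4"] by simp
  then have \<eta>_sum: "sum \<eta> I \<le> \<tau> / 4" if "finite I" for I
    using sum_le_suminf[of \<eta> I] that \<eta>_pos by (simp add: sums_iff less_imp_le)
  obtain F where F: "\<And>k. finite (F k)" "\<And>k. F k \<subseteq> A k" and net: "\<And>f. norm f \<le> 1 \<Longrightarrow>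
      \<exists>g u. LKK_chain \<eta> f g \<and>
        (\<forall>k. u k \<in> F k \<and> dist (u k) (g (Suc k) - g k) \<le> 2 * (\<eta> (Suc k) + \<eta> k))"
    using finite_increment_nets[OF \<open>c \<le> 1\<close>, of \<eta>] \<eta>_pos by metis
  have "\<exists>u. (\<forall>k. u k \<in> F k) \<and>
      (\<forall>n. (\<Sum>k<n. norm (u k)) \<le> (1 + \<tau>) / c + \<tau> \<and> infdist (f - (\<Sum>k<n. u k)) (A n) \<le> \<tau>)"
    if "norm f \<le> 1" for f
  proof -
    obtain g u where g: "LKK_chain \<eta> f g" and u: "\<And>k. u k \<in> F k"
      and near: "\<And>k. dist (u k) (g (Suc k) - g k) \<le> 2 * (\<eta> (Suc k) + \<eta> k)"
      using net[OF \<open>norm f \<le> 1\<close>] by blast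
    have "norm (g (Suc k) - g k - u k) \<le> 4 * \<eta> k" for k
      using near[of k] \<eta>_antimono[of k] by (simp add: dist_norm norm_minus_commute)
    then have "(\<Sum>k<n. norm (g (Suc k) - g k - u k)) \<le> (\<Sum>k<n. 4 * \<eta> k)" for n
      by (rule sum_mono)
    also have "(\<Sum>k<n. 4 * \<eta> k) \<le> \<tau>" for n
      using \<eta>_sum[of "{..<n}"] by (simp flip: sum_distrib_left)
    finally have error: "(\<Sum>k<n. norm (g (Suc k) - g k - u k)) \<le> \<tau>" for n .
    have "(1 + (\<Sum>k\<le>n. \<eta> k)) / c \<le> (1 + \<tau>) / c" for n
      using \<eta>_sum[of "{..n}"] \<open>\<tau> > 0\<close> c_pos by (simp add: divide_right_mono)
    then have "(\<Sum>k<n. norm (u k)) \<le> (1 + \<tau>) / c + \<tau>" for n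
      using LKK_chain_perturbation_variation_le[OF g, of u n] error[of n] by (smt (verit))
    moreover have "infdist (f - (\<Sum>k<n. u k)) (A n) \<le> \<tau>" for n
      using LKK_chain_perturbation_infdist_le[OF g, of u n] error[of n] by linarith
    ultimately show ?thesis using u by blast
  qed
  with F show ?thesis by blast
qed

subsection \<open>A weak-star null norming sequence\<close>

lemma weak_star_null_normalized_enumeration:
  assumes fin: "\<And>k. finite (F k)" and nonempty: "\<And>k. F k \<noteq> {}" and F: "\<And>k. F k \<subseteq> A k"
  shows "\<exists>\<phi>. weak_star_null \<phi> \<and> (\<forall>n. norm (\<phi> n) \<le> 1) \<and> (\<forall>k. sgn ` F k \<subseteq> range \<phi>)"
proof -
  obtain \<phi> :: "nat \<Rightarrow> 'a \<Rightarrow>\<^sub>L real" where range: "range \<phi> = (\<Union>k. sgn ` F k)"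
    and tail: "\<And>k. \<forall>\<^sub>F n in sequentially. \<phi> n \<in> (\<Union>i\<in>{k..}. sgn ` F i)"
    using finite_family_enumeration[of "\<lambda>k. sgn ` F k"] fin nonempty by (auto simp: image_Union)
  have bound: "norm (\<phi> n) \<le> 1" for n
  proof -
    have "\<phi> n \<in> (\<Union>k. sgn ` F k)" using range by blast
    then show ?thesis by (auto simp: norm_sgn)
  qed
  have "sgn ` F i \<subseteq> A k" if "k \<le> i" for i k
    using F[of i] A_antimono[OF that] subspace_mul[OF subspace_annihilator]
    by (fastforce simp: sgn_div_norm)
  then have tail_subset: "(\<Union>i\<in>{k..}. sgn ` F i) \<subseteq> A k" for k by blast
  have "\<forall>\<^sub>F n in sequentially. \<phi> n \<in> A k" for k
    using tail[of k] by (rule eventually_mono) (rule subsetD[OF tail_subset])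
  then have "weak_star_null \<phi>"
    by (rule weak_star_nullI_annihilator[OF dense bound])
  with bound range show ?thesis by blast
qed

lemma norm_le_c0_norm_evaluation_if_decomposed:
  assumes null: "weak_star_null \<phi>" and range: "\<And>k. sgn (u k) \<in> range \<phi>"
    and "blinfun_apply f x = norm x" and x: "x \<in> d ` {..<n}"
    and sum: "(\<Sum>k<n. norm (u k)) \<le> C" and close: "infdist (f - (\<Sum>k<n. u k)) (A n) \<le> \<tau>"
  shows "(1 - \<tau>) * norm x \<le> C * c0_norm (evaluation \<phi> x)"
proof -
  have "norm x = (f - (\<Sum>k<n. u k)) x + (\<Sum>k<n. u k x)"
    using assms(3) by (simp add: blinfun.diff_left blinfun.sum_left)
  also have "(f - (\<Sum>k<n. u k)) x \<le> \<tau> * norm x"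
    using abs_apply_le_infdist_annihilator[OF x, of "f - (\<Sum>k<n. u k)"]
      mult_right_mono[OF close norm_ge_zero[of x]] by linarith
  also have "(\<Sum>k<n. u k x) \<le> (\<Sum>k<n. norm (u k) * c0_norm (evaluation \<phi> x))"
    using abs_apply_le_norm_times_c0_norm_evaluation[OF null range]
    by (intro sum_mono) (meson abs_ge_self order_trans)
  also have "\<dots> = (\<Sum>k<n. norm (u k)) * c0_norm (evaluation \<phi> x)"
    by (simp add: sum_distrib_right)
  also have "\<dots> \<le> C * c0_norm (evaluation \<phi> x)"
    by (intro mult_right_mono sum c0_norm_nonneg evaluation_in_c0 null)
  finally show ?thesis by (simp add: algebra_simps)
qed

lemma norming_sequence:
  assumes "c \<le> 1" "\<epsilon> > 0"
  shows "\<exists>\<phi> :: nat \<Rightarrow> 'a \<Rightarrow>\<^sub>L real. weak_star_null \<phi> \<and> (\<forall>n. norm (\<phi> n) \<le> 1) \<and>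
    (\<forall>x. norm x \<le> (1 / c + \<epsilon>) * c0_norm (evaluation \<phi> x))"
proof -
  obtain \<tau> where "0 < \<tau>" "\<tau> < 1" and \<tau>_eq: "(1 + \<tau>) / c + \<tau> = (1 - \<tau>) * (1 / c + \<epsilon>)"
    using exists_perturbation_constant[of "1 / c" \<epsilon>] c_pos \<open>\<epsilon> > 0\<close> by auto
  obtain F where F: "\<And>k. finite (F k)" "\<And>k. F k \<subseteq> A k"
    and decomposition: "\<And>f. norm f \<le> 1 \<Longrightarrow> \<exists>u. (\<forall>k. u k \<in> F k) \<and> (\<forall>n.
      (\<Sum>k<n. norm (u k)) \<le> (1 + \<tau>) / c + \<tau> \<and> infdist (f - (\<Sum>k<n. u k)) (A n) \<le> \<tau>)"
    using dual_ball_decomposition[OF \<open>c \<le> 1\<close> \<open>0 < \<tau>\<close>] by metis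
  have "F k \<noteq> {}" for k
    using decomposition[of 0] by fastforce
  then obtain \<phi> where null: "weak_star_null \<phi>" and bound: "\<And>n. norm (\<phi> n) \<le> 1"
    and range: "\<And>k. sgn ` F k \<subseteq> range \<phi>"
    using weak_star_null_normalized_enumeration[of F] F by metis
  have "norm x \<le> (1 / c + \<epsilon>) * c0_norm (evaluation \<phi> x)" for x
  proof (rule norm_le_c0_norm_evaluation_if_dense[OF null bound dense])
    fix x assume "x \<in> range d"
    then obtain j where "x = d j" by blast
    obtain f :: "'a \<Rightarrow>\<^sub>L real" where f: "norm f \<le> 1" "f x = norm x"
      by (rule norming_functional)
    obtain u where "\<And>k. u k \<in> F k" and variation: "\<And>n. (\<Sum>k<n. norm (u k)) \<le> (1 + \<tau>) / c + \<tau>"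
      and close: "\<And>n. infdist (f - (\<Sum>k<n. u k)) (A n) \<le> \<tau>"
      using decomposition[OF f(1)] by metis
    then have "sgn (u k) \<in> range \<phi>" for k
      using range by blast
    moreover have "x \<in> d ` {..<Suc j}"
      using \<open>x = d j\<close> by blast
    ultimately have "(1 - \<tau>) * norm x \<le> ((1 + \<tau>) / c + \<tau>) * c0_norm (evaluation \<phi> x)"
      using norm_le_c0_norm_evaluation_if_decomposed[OF null _ f(2) _ variation close] by blast
    then have "(1 - \<tau>) * norm x \<le> (1 - \<tau>) * ((1 / c + \<epsilon>) * c0_norm (evaluation \<phi> x))"
      by (simp add: \<tau>_eq mult.assoc)
    then show "norm x \<le> (1 / c + \<epsilon>) * c0_norm (evaluation \<phi> x)"
      using \<open>\<tau> < 1\<close> by (meson mult_le_cancel_left_pos diff_gt_0_iff_gt)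
  qed
  with null bound show ?thesis by blast
qed

end

lemma LKK_star_of_separable:
  assumes "c_LKK_star c TYPE('a::real_normed_vector)" "0 < c" "separable_space TYPE('a)"
  obtains d :: "nat \<Rightarrow> 'a::real_normed_vector" where "LKK_star c d"
proof -
  obtain D :: "'a set" where D: "countable D" "closure D = UNIV"
    using assms(3) unfolding separable_space_def by blast
  then have "D \<noteq> {}" by auto
  then have "LKK_star c (from_nat_into D)"
    using D assms(1,2) by unfold_locales (simp_all add: range_from_nat_into)
  then show thesis by (rule that)
qed

lemma LKK_star_imp_bm_dist_c0_le:
  assumes "c_LKK_star c TYPE('a::banach)" "separable_space TYPE('a)"
    and "0 < c" "c \<le> 1" "\<epsilon> > 0"
  shows "\<exists>E. c0_linear_subspace E \<and> c0_closed E \<and> bm_dist_c0 TYPE('a) E \<le> ereal (1 / c + \<epsilon>)"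
proof -
  obtain d :: "nat \<Rightarrow> 'a" where "LKK_star c d"
    using LKK_star_of_separable[OF assms(1,3,2)] .
  then obtain \<phi> :: "nat \<Rightarrow> 'a \<Rightarrow>\<^sub>L real" where "weak_star_null \<phi>" "\<And>n. norm (\<phi> n) \<le> 1"
    "\<And>x. norm x \<le> (1 / c + \<epsilon>) * c0_norm (evaluation \<phi> x)"
    using LKK_star.norming_sequence[OF _ \<open>c \<le> 1\<close> \<open>\<epsilon> > 0\<close>] by metis
  moreover have "0 \<le> 1 / c + \<epsilon>" using \<open>0 < c\<close> \<open>\<epsilon> > 0\<close> by simp
  ultimately have embedding: "c0_embedding (evaluation \<phi>) 1 (1 / c + \<epsilon>)"
    by (intro c0_embedding_evaluation)
  then have "c0_linear_subspace (range (evaluation \<phi>))"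
    by (intro c0_linear_subspace_range c0_embedding.linear c0_embedding.range_subset)
  moreover have "c0_closed (range (evaluation \<phi>))"
    using embedding by (rule c0_closed_range)
  moreover have "bm_dist_c0 TYPE('a) (range (evaluation \<phi>)) \<le> ereal (1 / c + \<epsilon>)"
    using c0_embedding.bm_dist_c0_range_le[OF embedding] by simp
  ultimately show ?thesis by blast
qed

theorem theorem2p4:
  fixes c :: real
  assumes "0 < c" and "c \<le> 1"
    and "separable_space TYPE('a::banach)"
    and "c_LKK_star c TYPE('a)"
  shows "\<forall>\<epsilon>>0. \<exists>E. c0_linear_subspace E \<and> c0_closed E \<and>
           bm_dist_c0 TYPE('a) E \<le> ereal (1 / c^2 + \<epsilon>)"
proof (intro allI impI)
  fix \<epsilon> :: real assume "\<epsilon> > 0"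
  then obtain E where "c0_linear_subspace E" "c0_closed E"
    and "bm_dist_c0 TYPE('a) E \<le> ereal (1 / c + \<epsilon>)"
    using LKK_star_imp_bm_dist_c0_le[OF assms(4,3,1,2)] by blast
  moreover have "1 / c \<le> 1 / c\<^sup>2"
    using \<open>0 < c\<close> \<open>c \<le> 1\<close> by (simp add: field_simps power2_eq_square)
  then have "ereal (1 / c + \<epsilon>) \<le> ereal (1 / c\<^sup>2 + \<epsilon>)" by simp
  ultimately show "\<exists>E. c0_linear_subspace E \<and> c0_closed E \<and>
      bm_dist_c0 TYPE('a) E \<le> ereal (1 / c^2 + \<epsilon>)"
    by (meson order_trans)
qed

end
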